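(* Let $\lambda>0$, $\pi\in\mathcal{M}$, and let $\delta_\lambda:\mathcal{Z}\times\mathcal{G}\times\bar{\mathcal{G}}\to\mathbb{R}$ satisfy the online variance inequality. For any sequence $Z_1,\dots,Z_n\in\mathcal{Z}$, the cumulative loss of the online SeqRand algorithm satisfies $$\sum_{i=1}^n\mathbb{E}_{\hat g_{i-1}}L(Z_i,\hat g_{i-1})\le\min_{\rho\in\mathcal{M}}\left\{\mathbb{E}_{g\sim\rho}\sum_{i=1}^nL(Z_i,g)+\mathbb{E}_{g\sim\rho}\mathbb{E}_{\hat g_0^{n-1}}\sum_{i=1}^n\delta_\lambda(Z_i,g,\hat g_{i-1})+\frac{K(\rho,\pi)}{\lambda}\right\}.$$ In particular, when $\mathcal{G}$ is finite, by taking $\pi$ uniform on $\mathcal{G}$, we get $$\sum_{i=1}^n\mathbb{E}_{\hat g_{i-1}}L(Z_i,\hat g_{i-1})\le\min_{g\in\mathcal{G}}\left\{\sum_{i=1}^nL(Z_i,g)+\mathbb{E}_{\hat g_0^{n-1}}\sum_{i=1}^n\delta_\lambda(Z_i,g,\hat g_{i-1})+\frac{\log|\mathcal{G}|}{\lambda}\right\}.$$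
   Context: Setting (sequential prediction). The data points $Z_1,\dots,Z_n\in\mathcal{Z}=\mathcal{X}\times\mathcal{Y}$ come one by one, without any probabilistic assumption on how they are generated. $\bar{\mathcal{G}}$ is the set of all prediction functions (measurable functions $\mathcal{X}\to\mathcal{Y}$), equipped with a $\sigma$-algebra; $\mathcal{D}$ is the set of probability distributions on $\bar{\mathcal{G}}$; $\mathcal{G}\subset\bar{\mathcal{G}}$ is a measurable space and $\mathcal{M}$ is the set of probability distributions on $\mathcal{G}$. $L:\mathcal{Z}\times\bar{\mathcal{G}}\to\mathbb{R}$ is a loss function. For measurable $h:\mathcal{G}\to\mathbb{R}$, $\pi_{-h}(dg)=\frac{e^{-h(g)}}{\mathbb{E}_{g'\sim\pi}e^{-h(g')}}\,\pi(dg)$. $K(\rho,\pi)$ is the Kullback–Leibler divergence ($+\infty$ if $\rho\not\ll\pi$). Measurability of the manipulated quantities is implicitly assumed. Online variance inequality: for every $\rho\in\mathcal{M}$ there exists $\hat\pi(\rho)\in\mathcal{D}$ such that for every $z\in\mathcal{Z}$, $\mathbb{E}_{g'\sim\hat\pi(\rho)}\log\mathbb{E}_{g\sim\rho}e^{\lambda[L(z,g')-L(z,g)-\delta_\lambda(z,g,g')]}\le0$. Online SeqRand algorithm. (1) Let $\hat\rho_0=\hat\pi(\pi)$ in the sense of the online variance inequality and draw $\hat g_0$ according to $\hat\rho_0$; for data $Z_1$, predict according to $\hat g_0$. Let $S_0\equiv0$ on $\mathcal{G}$. (2) For $i=1,\dots,n-1$, let $S_i(g)=S_{i-1}(g)+L(Z_i,g)+\delta_\lambda(Z_i,g,\hat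 g_{i-1})$ for all $g\in\mathcal{G}$, let $\hat\rho_i=\hat\pi(\pi_{-\lambda S_i})$ in the sense of the online variance inequality, draw $\hat g_i$ according to $\hat\rho_i$, and for data $Z_{i+1}$ predict according to $\hat g_i$. The expectations $\mathbb{E}_{\hat g_{i-1}}$ and $\mathbb{E}_{\hat g_0^{n-1}}$ are with respect to the draws of $\hat g_0^{n-1}=(\hat g_0,\dots,\hat g_{n-1})$ by the algorithm.
   Formalization: The minimum over ρ need not be attained, so the bound is stated with the infimum (over ρ for which the expression is defined); a minimiser is asserted only when the summed losses and the expected summed δ are bounded below in g. The cumulative loss is assumed to be well defined. *)

theory Defs
  imports "HOL-Probability.Probability"
begin

text \<open>Prediction functions are the measurable functions between the carriers; they are
  normalised to \<^const>\<open>undefined\<close> outside the carrier of the input space, so that equality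
  (and the cardinality of a set of them) is that of functions on the carrier.\<close>

definition prediction_functions :: "'x measure \<Rightarrow> 'y measure \<Rightarrow> ('x \<Rightarrow> 'y) set" where
  "prediction_functions MX MY = (MX \<rightarrow>\<^sub>M MY) \<inter> extensional (space MX)"

text \<open>Expectation with values in \<open>[-\<infinity>, \<infinity>]\<close>. On \<^typ>\<open>ereal\<close> we have \<open>\<infinity> - \<infinity> = \<infinity>\<close>, so an
  expectation whose positive and negative parts are both infinite gets the value \<open>\<infinity>\<close>. In
  particular \<open>ext_expectation M f \<le> 0\<close> includes the claim that the expectation exists, and an
  upper bound by an ill-defined expectation is void.\<close>

definition ext_expectation :: "'a measure \<Rightarrow> ('a \<Rightarrow> ereal) \<Rightarrow> ereal" where
  "ext_expectation M f =
     enn2ereal (\<integral>\<^sup>+x. e2ennreal (f x) \<partial>M) - enn2ereal (\<integral>\<^sup>+x. e2ennreal (- f x) \<partial>M)"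

definition ext_ln :: "ennreal \<Rightarrow> ereal" where
  "ext_ln x = (if x = 0 then -\<infinity> else if x = \<infinity> then \<infinity> else ereal (ln (enn2real x)))"

text \<open>Kullback--Leibler divergence \<open>K(\<rho>, \<pi>)\<close>; note that the library's \<^const>\<open>KL_divergence\<close> takes
  the reference measure first. For \<open>\<rho> \<lless> \<pi>\<close> the negative part of \<open>ln (d\<rho>/d\<pi>)\<close> is always
  \<open>\<rho>\<close>-integrable, hence non-integrability means that the divergence is \<open>\<infinity>\<close> (where the library's
  Bochner integral would be 0).\<close>

definition KL :: "'a measure \<Rightarrow> 'a measure \<Rightarrow> ereal" where
  "KL \<rho> \<pi> =
     (if absolutely_continuous \<pi> \<rho> \<and> integrable \<rho> (entropy_density (exp 1) \<pi> \<rho>)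
      then ereal (KL_divergence (exp 1) \<pi> \<rho>) else \<infinity>)"

text \<open>The distribution \<open>\<pi>\<^bsub>-h\<^esub>\<close>. It is a probability distribution iff the normalising constant
  is finite; otherwise the density below is 0.\<close>

definition gibbs :: "'a measure \<Rightarrow> ('a \<Rightarrow> real) \<Rightarrow> 'a measure" where
  "gibbs \<pi> h =
     density \<pi> (\<lambda>g. ennreal (exp (- h g)) / (\<integral>\<^sup>+g'. ennreal (exp (- h g')) \<partial>\<pi>))"

text \<open>The map \<open>pihat\<close> selects, for every \<open>\<rho>\<close>, a distribution whose existence is required by the
  online variance inequality. \<open>Zs\<close> is the data space, \<open>G\<close> the model and \<open>GB\<close> the set of all
  prediction functions.\<close>

definition online_variance_inequality ::
  "'z set \<Rightarrow> 'g measure \<Rightarrow> 'g measure \<Rightarrow> ('z \<Rightarrow> 'g \<Rightarrow> real) \<Rightarrow> real \<Rightarrow> ('z \<Rightarrow> 'g \<Rightarrow> 'g \<Rightarrow> real) \<Rightarrow>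
   ('g measure \<Rightarrow> 'g measure) \<Rightarrow> bool" where
  "online_variance_inequality Zs G GB L lam \<delta> pihat \<longleftrightarrow>
     (\<forall>\<rho>\<in>space (prob_algebra G).
        pihat \<rho> \<in> space (prob_algebra GB) \<and>
        (\<forall>z\<in>Zs. ext_expectation (pihat \<rho>)
           (\<lambda>g'. ext_ln (\<integral>\<^sup>+g. ennreal (exp (lam * (L z g' - L z g - \<delta> z g g'))) \<partial>\<rho>)) \<le> 0))"

text \<open>In the following, \<open>\<omega> j\<close> is the function \<open>ghat\<^sub>j\<close> drawn by the algorithm. The data are
  \<open>Z 1, \<dots>, Z n\<close>; the value \<open>Z 0\<close> is never used.\<close>

primrec seqrand_S ::
  "('z \<Rightarrow> 'g \<Rightarrow> real) \<Rightarrow> ('z \<Rightarrow> 'g \<Rightarrow> 'g \<Rightarrow> real) \<Rightarrow> (nat \<Rightarrow> 'z) \<Rightarrow> (nat \<Rightarrow> 'g) \<Rightarrow> nat \<Rightarrow> 'g \<Rightarrow> real"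
where
  "seqrand_S L \<delta> Z \<omega> 0 = (\<lambda>g. 0)"
| "seqrand_S L \<delta> Z \<omega> (Suc i) =
     (\<lambda>g. seqrand_S L \<delta> Z \<omega> i g + L (Z (Suc i)) g + \<delta> (Z (Suc i)) g (\<omega> i))"

text \<open>The distribution from which \<open>ghat\<^sub>i\<close> is drawn, given the previous draws
  \<open>\<omega> 0, \<dots>, \<omega> (i - 1)\<close>.\<close>

definition seqrand_rho ::
  "('z \<Rightarrow> 'g \<Rightarrow> real) \<Rightarrow> real \<Rightarrow> ('z \<Rightarrow> 'g \<Rightarrow> 'g \<Rightarrow> real) \<Rightarrow> ('g measure \<Rightarrow> 'g measure) \<Rightarrow>
   'g measure \<Rightarrow> (nat \<Rightarrow> 'z) \<Rightarrow> nat \<Rightarrow> (nat \<Rightarrow> 'g) \<Rightarrow> 'g measure" where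
  "seqrand_rho L lam \<delta> pihat \<pi> Z i \<omega> =
     (if i = 0 then pihat \<pi> else pihat (gibbs \<pi> (\<lambda>g. lam * seqrand_S L \<delta> Z \<omega> i g)))"

text \<open>Joint law of the first \<open>n\<close> draws, as a measure on the product space indexed by
  \<open>{0..<n}\<close> (composition of kernels as in \<^locale>\<open>Ionescu_Tulcea\<close>).\<close>

primrec seqrand_law ::
  "'g measure \<Rightarrow> ('z \<Rightarrow> 'g \<Rightarrow> real) \<Rightarrow> real \<Rightarrow> ('z \<Rightarrow> 'g \<Rightarrow> 'g \<Rightarrow> real) \<Rightarrow>
   ('g measure \<Rightarrow> 'g measure) \<Rightarrow> 'g measure \<Rightarrow> (nat \<Rightarrow> 'z) \<Rightarrow> nat \<Rightarrow> (nat \<Rightarrow> 'g) measure" where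
  "seqrand_law GB L lam \<delta> pihat \<pi> Z 0 = return (PiM {0..<0} (\<lambda>_. GB)) (\<lambda>_. undefined)"
| "seqrand_law GB L lam \<delta> pihat \<pi> Z (Suc i) =
     seqrand_law GB L lam \<delta> pihat \<pi> Z i \<bind>
       (\<lambda>\<omega>. distr (seqrand_rho L lam \<delta> pihat \<pi> Z i \<omega>)
               (PiM {0..<Suc i} (\<lambda>_. GB)) (fun_upd \<omega> i))"

text \<open>In the remaining definitions, \<open>law\<close> is the joint law of the draws \<open>\<omega> 0, \<dots>, \<omega> (n - 1)\<close>.\<close>

definition expected_cum_loss ::
  "(nat \<Rightarrow> 'g) measure \<Rightarrow> ('z \<Rightarrow> 'g \<Rightarrow> real) \<Rightarrow> (nat \<Rightarrow> 'z) \<Rightarrow> nat \<Rightarrow> ereal" where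
  "expected_cum_loss law L Z n =
     (\<Sum>i=1..n. ext_expectation law (\<lambda>\<omega>. ereal (L (Z i) (\<omega> (i - 1)))))"

definition expected_cum_delta ::
  "(nat \<Rightarrow> 'g) measure \<Rightarrow> ('z \<Rightarrow> 'g \<Rightarrow> 'g \<Rightarrow> real) \<Rightarrow> (nat \<Rightarrow> 'z) \<Rightarrow> nat \<Rightarrow> 'g \<Rightarrow> ereal" where
  "expected_cum_delta law \<delta> Z n g =
     ext_expectation law (\<lambda>\<omega>. ereal (\<Sum>i=1..n. \<delta> (Z i) g (\<omega> (i - 1))))"

definition seqrand_bound ::
  "(nat \<Rightarrow> 'g) measure \<Rightarrow> ('z \<Rightarrow> 'g \<Rightarrow> real) \<Rightarrow> real \<Rightarrow> ('z \<Rightarrow> 'g \<Rightarrow> 'g \<Rightarrow> real) \<Rightarrow>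
   'g measure \<Rightarrow> (nat \<Rightarrow> 'z) \<Rightarrow> nat \<Rightarrow> 'g measure \<Rightarrow> ereal" where
  "seqrand_bound law L lam \<delta> \<pi> Z n \<rho> =
     ext_expectation \<rho> (\<lambda>g. ereal (\<Sum>i=1..n. L (Z i) g))
     + ext_expectation \<rho> (expected_cum_delta law \<delta> Z n)
     + KL \<rho> \<pi> / ereal lam"

text \<open>The sum of the expected losses makes sense in \<open>[-\<infinity>, \<infinity>]\<close>: all its terms exist, and
  \<open>\<infinity>\<close> and \<open>-\<infinity>\<close> do not both occur among them.\<close>

definition cum_loss_exists ::
  "(nat \<Rightarrow> 'g) measure \<Rightarrow> ('z \<Rightarrow> 'g \<Rightarrow> real) \<Rightarrow> (nat \<Rightarrow> 'z) \<Rightarrow> nat \<Rightarrow> bool" where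
  "cum_loss_exists law L Z n \<longleftrightarrow>
     (\<forall>i\<in>{1..n}. (\<integral>\<^sup>+\<omega>. ennreal (- L (Z i) (\<omega> (i - 1))) \<partial>law) < \<infinity>) \<or>
     (\<forall>i\<in>{1..n}. (\<integral>\<^sup>+\<omega>. ennreal (L (Z i) (\<omega> (i - 1))) \<partial>law) < \<infinity>)"

end

theory Submission
  imports Defs
begin

text \<open>Let \<open>W k = E\<^bsub>\<pi>\<^esub> exp (- lam * S k)\<close>. The online variance inequality for the \<open>k\<close>-th Gibbs measure says
  that \<open>M k = lam * (\<Sum>i\<le>k. L (Z i) (\<omega> (i - 1))) + ln (W k)\<close> is a supermartingale, so that
  \<open>lam * E (\<Sum>i. L (Z i) (\<omega> (i - 1))) \<le> - E (ln (W n))\<close>. The Donsker--Varadhan inequality bounds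
  \<open>- ln (W n)\<close> by \<open>lam * E\<^bsub>\<rho>\<^esub> (S n) + K(\<rho>, \<pi>)\<close>, and exchanging the two expectations gives the bound.

  No integrability is assumed, so this order of the argument is not available. Instead put
  \<open>Y g \<omega> = lam * S n g + ln (W n)\<close>. As \<open>E\<^bsub>\<pi>\<^esub> exp (- Y g \<omega>) = 1\<close> for almost all \<open>\<omega>\<close>, the negative part of
  \<open>Y\<close> is jointly integrable. If the claimed bound is not \<open>\<infinity>\<close>, then the negative part of \<open>M n\<close> is
  integrable as well, which turns \<open>M\<close> into a genuine supermartingale and makes all terms of
  \<open>lam * (\<Sum>i. L (Z i) (\<omega> (i - 1))) + Y g \<omega> = lam * S n g + M n\<close> integrable. The expectations are then
  exchanged for \<open>Y\<close> only.\<close>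

section \<open>Expectations in the extended reals\<close>

lemma integrable_real_parts:
  fixes f :: "'a \<Rightarrow> real"
  assumes "integrable M f"
  obtains a b where "(\<integral>\<^sup>+x. ennreal (f x) \<partial>M) = ennreal a" "(\<integral>\<^sup>+x. ennreal (- f x) \<partial>M) = ennreal b"
    "0 \<le> a" "0 \<le> b" "(\<integral>x. f x \<partial>M) = a - b"
proof -
  have "(\<integral>\<^sup>+x. ennreal (f x) \<partial>M) < top" "(\<integral>\<^sup>+x. ennreal (- f x) \<partial>M) < top"
    using assms by (auto simp: real_integrable_def less_top)
  then obtain a b where ab: "0 \<le> a" "(\<integral>\<^sup>+x. ennreal (f x) \<partial>M) = ennreal a"
      "0 \<le> b" "(\<integral>\<^sup>+x. ennreal (- f x) \<partial>M) = ennreal b"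
    by (metis less_top_ennreal)
  show ?thesis
    using ab assms by (intro that[of a b]) (simp_all add: real_lebesgue_integral_def)
qed

lemma ext_expectation_integrable:
  assumes "integrable M f"
  shows "ext_expectation M (\<lambda>x. ereal (f x)) = ereal (\<integral>x. f x \<partial>M)"
proof -
  obtain a b where "(\<integral>\<^sup>+x. ennreal (f x) \<partial>M) = ennreal a" "(\<integral>\<^sup>+x. ennreal (- f x) \<partial>M) = ennreal b"
    "0 \<le> a" "0 \<le> b" "(\<integral>x. f x \<partial>M) = a - b"
    using integrable_real_parts[OF assms] .
  then show ?thesis by (simp add: ext_expectation_def enn2ereal_ennreal)
qed

lemma ext_expectation_cong_AE:
  assumes "AE x in M. f x = g x"
  shows "ext_expectation M f = ext_expectation M g"
proof -
  have "(\<integral>\<^sup>+x. e2ennreal (f x) \<partial>M) = (\<integral>\<^sup>+x. e2ennreal (g x) \<partial>M)"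
       "(\<integral>\<^sup>+x. e2ennreal (- f x) \<partial>M) = (\<integral>\<^sup>+x. e2ennreal (- g x) \<partial>M)"
    using assms by (auto intro!: nn_integral_cong_AE)
  then show ?thesis by (simp add: ext_expectation_def)
qed

text \<open>In \<open>ereal\<close>, \<infinity> minus anything is \<infinity>, and this includes
  \<infinity> - \<infinity>. So an infinite positive part can never be hidden by an infinite
  negative part.\<close>

lemma pos_part_finite_of_ext_expectation:
  assumes "ext_expectation M f < \<infinity>"
  shows "(\<integral>\<^sup>+x. e2ennreal (f x) \<partial>M) < \<infinity>"
proof (rule ccontr)
  assume "\<not> ?thesis"
  then have "enn2ereal (\<integral>\<^sup>+x. e2ennreal (f x) \<partial>M) = \<infinity>"
    by (simp add: less_top[symmetric])
  with assms show False by (simp add: ext_expectation_def)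
qed

lemma AE_less_infty_of_ext_expectation:
  assumes "ext_expectation M f < \<infinity>" and [measurable]: "f \<in> borel_measurable M"
  shows "AE x in M. f x < \<infinity>"
proof -
  have "AE x in M. e2ennreal (f x) \<noteq> \<infinity>"
    using pos_part_finite_of_ext_expectation[OF assms(1)]
    by (intro nn_integral_PInf_AE) auto
  then show ?thesis by eventually_elim (auto simp: less_top[symmetric])
qed

lemma ext_expectation_eq_MInf:
  assumes "(\<integral>\<^sup>+x. e2ennreal (f x) \<partial>M) < \<infinity>" "(\<integral>\<^sup>+x. e2ennreal (- f x) \<partial>M) = \<infinity>"
  shows "ext_expectation M f = - \<infinity>"
  using assms by (cases "\<integral>\<^sup>+x. e2ennreal (f x) \<partial>M") (auto simp: ext_expectation_def enn2ereal_ennreal)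

lemma ext_expectation_return:
  assumes "x \<in> space M" "f \<in> borel_measurable M"
  shows "ext_expectation (return M x) f = f x"
proof -
  have "ext_expectation (return M x) f = enn2ereal (e2ennreal (f x)) - enn2ereal (e2ennreal (- f x))"
    using assms by (simp add: ext_expectation_def nn_integral_return)
  also have "\<dots> = f x"
    by (cases "f x" ; cases "f x \<ge> 0")
       (auto simp: enn2ereal_ennreal ennreal_neg e2ennreal_neg
          zero_ennreal.rep_eq)
  finally show ?thesis .
qed

lemma integrableI_parts:
  fixes f :: "'a \<Rightarrow> real"
  assumes "f \<in> borel_measurable M"
    and "(\<integral>\<^sup>+x. ennreal (f x) \<partial>M) < \<infinity>" "(\<integral>\<^sup>+x. ennreal (- f x) \<partial>M) < \<infinity>"
  shows "integrable M f"
  using assms by (simp add: real_integrable_def less_top)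

text \<open>\<open>ennreal\<close> sends negative reals to 0, so the integral on the right is that
  of the positive part. This lets one-sided finiteness enter the domination arguments below.\<close>

lemma integrable_pos_part_iff:
  fixes f :: "'a \<Rightarrow> real"
  assumes [measurable]: "f \<in> borel_measurable M"
  shows "integrable M (\<lambda>x. max 0 (f x)) \<longleftrightarrow> (\<integral>\<^sup>+x. ennreal (f x) \<partial>M) < \<infinity>"
proof -
  have "(\<integral>\<^sup>+x. ennreal (norm (max 0 (f x))) \<partial>M) = (\<integral>\<^sup>+x. ennreal (f x) \<partial>M)"
    by (intro nn_integral_cong) (auto simp: max_def ennreal_neg)
  then show ?thesis by (simp add: integrable_iff_bounded)
qed

text \<open>The positive parts add up to the sum plus the negative parts. Integrability of the sum
  and of all negative parts therefore passes to every single summand.\<close>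

lemma ext_expectation_sum:
  fixes f :: "'i \<Rightarrow> 'a \<Rightarrow> real"
  assumes "finite I" and meas: "\<And>i. i \<in> I \<Longrightarrow> f i \<in> borel_measurable M"
    and neg: "\<And>i. i \<in> I \<Longrightarrow> (\<integral>\<^sup>+x. ennreal (- f i x) \<partial>M) < \<infinity>"
    and int: "integrable M (\<lambda>x. \<Sum>i\<in>I. f i x)"
  shows "(\<Sum>i\<in>I. ext_expectation M (\<lambda>x. ereal (f i x))) = ereal (\<integral>x. (\<Sum>i\<in>I. f i x) \<partial>M)"
proof -
  have int_neg: "integrable M (\<lambda>x. max 0 (- f i x))" if "i \<in> I" for i
    using meas neg that by (subst integrable_pos_part_iff) auto
  have int_f: "integrable M (f i)" if i: "i \<in> I" for i
  proof (rule Bochner_Integration.integrable_bound)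
    show "integrable M (\<lambda>x. \<bar>\<Sum>i\<in>I. f i x\<bar> + (\<Sum>i\<in>I. max 0 (- f i x)))"
      using int int_neg by auto
    show "AE x in M. norm (f i x) \<le> norm (\<bar>\<Sum>i\<in>I. f i x\<bar> + (\<Sum>i\<in>I. max 0 (- f i x)))"
    proof (intro AE_I2)
      fix x
      have "max 0 (f i x) \<le> (\<Sum>i\<in>I. max 0 (f i x))"
        using assms(1) i by (intro member_le_sum) auto
      also have "\<dots> = (\<Sum>i\<in>I. f i x) + (\<Sum>i\<in>I. max 0 (- f i x))"
        unfolding sum.distrib[symmetric] by (intro sum.cong) auto
      finally have "f i x \<le> \<bar>\<Sum>i\<in>I. f i x\<bar> + (\<Sum>i\<in>I. max 0 (- f i x))" by linarith
      moreover have "max 0 (- f i x) \<le> (\<Sum>i\<in>I. max 0 (- f i x))"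
        using assms(1) i by (intro member_le_sum) auto
      ultimately have "\<bar>f i x\<bar> \<le> \<bar>\<Sum>i\<in>I. f i x\<bar> + (\<Sum>i\<in>I. max 0 (- f i x))" by linarith
      then show "norm (f i x) \<le> norm (\<bar>\<Sum>i\<in>I. f i x\<bar> + (\<Sum>i\<in>I. max 0 (- f i x)))" by simp
    qed
  qed (use meas i in auto)
  then show ?thesis
    by (simp add: ext_expectation_integrable)
qed

section \<open>The Donsker--Varadhan inequality\<close>

lemma entropy_density_exp1:
  "entropy_density (exp 1) \<pi> \<rho> x = ln (enn2real (RN_deriv \<pi> \<rho> x))"
  by (simp add: entropy_density_def log_def)

text \<open>Donsker--Varadhan: at \<open>\<rho>\<close>-almost every point, \<open>- h \<le> u + v - 1\<close> with \<open>u\<close> the entropy density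
  and \<open>v = exp (- h - u)\<close>, whose \<open>\<rho>\<close>-integral is at most that of \<open>exp (- h)\<close> under \<open>\<pi>\<close>. The
  function \<open>e\<close> stands for \<open>exp (- h)\<close>, so that \<open>h = \<infinity>\<close> is possible on a \<open>\<rho>\<close>-null set.\<close>

context
  fixes \<pi> \<rho> :: "'a measure" and h :: "'a \<Rightarrow> real" and e :: "'a \<Rightarrow> ennreal"
  assumes prob: "prob_space \<pi>" "prob_space \<rho>" "sets \<rho> = sets \<pi>"
    and KL_finite: "KL \<rho> \<pi> < \<infinity>"
    and h[measurable]: "h \<in> borel_measurable \<pi>"
    and e[measurable]: "e \<in> borel_measurable \<pi>"
    and e_eq: "AE x in \<rho>. e x = ennreal (exp (- h x))"
    and e_le: "(\<integral>\<^sup>+x. e x \<partial>\<pi>) \<le> 1"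
begin

lemma donsker_varadhan_aux:
  obtains v where "integrable \<rho> v" "(\<integral>x. v x \<partial>\<rho>) \<le> 1" "\<And>x. 0 \<le> v x"
    "AE x in \<rho>. - h x \<le> entropy_density (exp 1) \<pi> \<rho> x + v x - 1"
proof -
  interpret \<pi>: prob_space \<pi> by fact
  interpret \<rho>: prob_space \<rho> by fact
  note [measurable_cong] = prob(3)
  have ac: "absolutely_continuous \<pi> \<rho>" and int: "integrable \<rho> (entropy_density (exp 1) \<pi> \<rho>)"
    using KL_finite by (auto simp: KL_def split: if_splits)
  define D where "D = RN_deriv \<pi> \<rho>"
  define u where "u = entropy_density (exp 1) \<pi> \<rho>"
  have [measurable]: "D \<in> borel_measurable \<pi>" by (simp add: D_def)
  have [measurable]: "u \<in> borel_measurable \<pi>" by (simp add: u_def entropy_density_def)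
  have dens: "density \<pi> D = \<rho>"
    unfolding D_def using ac prob(3) by (rule \<pi>.density_RN_deriv)
  have fin: "AE x in \<pi>. D x \<noteq> \<infinity>"
    unfolding D_def using ac prob(3) \<rho>.sigma_finite_measure_axioms by (intro \<pi>.RN_deriv_finite)
  define v where "v x = exp (- h x - u x)" for x
  have [measurable]: "v \<in> borel_measurable \<rho>" by (simp add: v_def[abs_def])
  have "(\<integral>\<^sup>+x. ennreal (v x) \<partial>\<rho>) = (\<integral>\<^sup>+x. e x * ennreal (exp (- u x)) \<partial>\<rho>)"
    using e_eq by (intro nn_integral_cong_AE, eventually_elim)
      (simp add: v_def exp_diff exp_minus divide_inverse ennreal_mult'')
  also have "\<dots> = (\<integral>\<^sup>+x. D x * (e x * ennreal (exp (- u x))) \<partial>\<pi>)"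
    by (subst dens[symmetric], rule nn_integral_density) measurable
  also have "\<dots> \<le> (\<integral>\<^sup>+x. e x \<partial>\<pi>)"
  \<comment> \<open>Where D > 0, the factor exp (- u) cancels D, since u = ln D. Where D = 0 the
    left side vanishes, so in general only an inequality holds.\<close>
  proof (intro nn_integral_mono_AE, use fin in eventually_elim)
    fix x assume "D x \<noteq> \<infinity>"
    then obtain r where r: "D x = ennreal r" "0 \<le> r" by (cases "D x") auto
    then have u: "u x = ln r" by (simp add: u_def entropy_density_exp1 D_def)
    show "D x * (e x * ennreal (exp (- u x))) \<le> e x"
    proof (cases "r = 0")
      case False
      then have "D x * ennreal (exp (- u x)) = 1"
        using r by (simp add: u exp_minus ennreal_mult[symmetric])
      then show ?thesis by (simp add: ac_simps mult.left_commute[of "D x"])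
    qed (simp add: r)
  qed
  also have "\<dots> \<le> 1" by (rule e_le)
  finally have v1: "(\<integral>\<^sup>+x. ennreal (v x) \<partial>\<rho>) \<le> 1" .
  have intv: "integrable \<rho> v"
    using v1 by (intro integrableI_nonneg) (auto simp: v_def intro: le_less_trans)
  show ?thesis
  proof (rule that[of v])
    show "integrable \<rho> v" by fact
    show "0 \<le> v x" for x by (simp add: v_def)
    show "(\<integral>x. v x \<partial>\<rho>) \<le> 1"
      using v1 by (subst integral_eq_nn_integral) (auto simp: v_def intro!: enn2real_leI)
    have "- h x \<le> u x + v x - 1" for x
      using exp_ge_add_one_self[of "- h x - u x"] unfolding v_def by linarith
    then show "AE x in \<rho>. - h x \<le> entropy_density (exp 1) \<pi> \<rho> x + v x - 1" 
      by (simp add: u_def)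
  qed
qed

text \<open>The bound does not depend on h and requires no integrability of h. It will be applied to
  a whole family of functions h, indexed by the draws, with one constant.\<close>

lemma donsker_varadhan_neg_part:
  "(\<integral>\<^sup>+x. ennreal (- h x) \<partial>\<rho>) \<le> ennreal ((\<integral>x. \<bar>entropy_density (exp 1) \<pi> \<rho> x\<bar> \<partial>\<rho>) + 1)"
proof -
  obtain v where v: "integrable \<rho> v" "(\<integral>x. v x \<partial>\<rho>) \<le> 1" "\<And>x. 0 \<le> v x"
    "AE x in \<rho>. - h x \<le> entropy_density (exp 1) \<pi> \<rho> x + v x - 1"
    by (rule donsker_varadhan_aux) blast
  have int: "integrable \<rho> (entropy_density (exp 1) \<pi> \<rho>)"
    using KL_finite by (auto simp: KL_def split: if_splits)
  have "(\<integral>\<^sup>+x. ennreal (- h x) \<partial>\<rho>) \<le> (\<integral>\<^sup>+x. ennreal (\<bar>entropy_density (exp 1) \<pi> \<rho> x\<bar> + v x) \<partial>\<rho>)"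
    using v(4) by (intro nn_integral_mono_AE, eventually_elim) (auto intro!: ennreal_leI)
  also have "\<dots> = ennreal (\<integral>x. \<bar>entropy_density (exp 1) \<pi> \<rho> x\<bar> + v x \<partial>\<rho>)"
    using int v by (intro nn_integral_eq_integral) auto
  also have "\<dots> \<le> ennreal ((\<integral>x. \<bar>entropy_density (exp 1) \<pi> \<rho> x\<bar> \<partial>\<rho>) + 1)"
    using int v by (intro ennreal_leI) simp
  finally show ?thesis .
qed

text \<open>Integrate the pointwise inequality: the integral of v - 1 is at most 0, so only the
  entropy density remains.\<close>

lemma donsker_varadhan:
  assumes "integrable \<rho> h"
  shows "ereal (- (\<integral>x. h x \<partial>\<rho>)) \<le> KL \<rho> \<pi>"
proof -
  interpret \<rho>: prob_space \<rho> by fact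
  obtain v where v: "integrable \<rho> v" "(\<integral>x. v x \<partial>\<rho>) \<le> 1" "\<And>x. 0 \<le> v x"
    "AE x in \<rho>. - h x \<le> entropy_density (exp 1) \<pi> \<rho> x + v x - 1"
    by (rule donsker_varadhan_aux) blast
  have int: "integrable \<rho> (entropy_density (exp 1) \<pi> \<rho>)" and
    KL: "KL \<rho> \<pi> = ereal (\<integral>x. entropy_density (exp 1) \<pi> \<rho> x \<partial>\<rho>)"
    using KL_finite by (auto simp: KL_def KL_divergence_def split: if_splits)
  have "(\<integral>x. - h x \<partial>\<rho>) \<le> (\<integral>x. entropy_density (exp 1) \<pi> \<rho> x + v x - 1 \<partial>\<rho>)"
    using assms int v by (intro integral_mono_AE) auto
  then show ?thesis
    using assms int v by (simp add: KL \<rho>.prob_space)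
qed

end

section \<open>Divergence of explicit densities\<close>

lemma (in prob_space) KL_density_eq:
  fixes f u :: "'a \<Rightarrow> real"
  assumes f[measurable]: "f \<in> borel_measurable M" and nonneg: "\<And>x. 0 \<le> f x"
    and u: "integrable (density M f) u" "AE x in density M f. ln (f x) = u x"
  shows "KL (density M f) M = ereal (\<integral>x. u x \<partial>density M f)"
proof -
  \<comment> \<open>The Radon-Nikodym derivative is determined up to null sets of M, and these are
    also null sets of the measure with density f.\<close>
  have "AE x in M. f x = RN_deriv M (density M f) x"
    by (intro RN_deriv_unique) auto
  then have "AE x in density M f. f x = RN_deriv M (density M f) x"
    by (subst AE_density) auto
  then have eq: "AE x in density M f. u x = entropy_density (exp 1) M (density M f) x"
    using u(2)
    by eventually_elim (metis entropy_density_exp1 enn2real_ennreal nonneg)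
  have [measurable]: "entropy_density (exp 1) M (density M f) \<in> borel_measurable M"
    by (simp add: entropy_density_def)
  have [measurable]: "u \<in> borel_measurable M"
    using u(1) by auto
  have "integrable (density M f) (entropy_density (exp 1) M (density M f))"
    using u(1) eq by (subst integrable_cong_AE[symmetric, OF _ _ eq]) auto
  moreover have "KL_divergence (exp 1) M (density M f) = (\<integral>x. u x \<partial>density M f)"
    unfolding KL_divergence_def by (intro integral_cong_AE[symmetric]) (use eq in auto)
  ultimately show ?thesis
    by (simp add: KL_def absolutely_continuousI_density)
qed

text \<open>With respect to the uniform measure, a point mass has density \<open>card S\<close>
  times the indicator of its point. The logarithm of this density is constant almost everywhere
  under the point mass.\<close>

lemma KL_return_uniform:
  assumes "finite S" "x \<in> S" "sets G = Pow S"
  shows "KL (return G x) (uniform_count_measure S) = ereal (ln (real (card S)))"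
proof -
  let ?\<pi> = "uniform_count_measure S"
  interpret prob_space ?\<pi>
    using assms by (intro prob_space_uniform_count_measure) auto
  let ?f = "\<lambda>y. real (card S) * indicator {x} y"
  have card: "card S > 0" using assms by (auto simp: card_gt_0_iff)
  have [measurable]: "f \<in> borel_measurable ?\<pi>" for f :: "_ \<Rightarrow> real"
    by (simp add: measurable_def)
  have space: "space G = S" using sets_eq_imp_space_eq[of G "count_space S"] assms by simp
  have dens: "density ?\<pi> ?f = return G x"
  proof (rule measure_eqI)
    fix A assume "A \<in> sets (density ?\<pi> ?f)"
    then have A: "A \<subseteq> S" by (simp add: sets_uniform_count_measure)
    have "emeasure (density ?\<pi> ?f) A = (\<integral>\<^sup>+y. ennreal (?f y) * indicator A y \<partial>?\<pi>)"
      using A by (intro emeasure_density) (auto simp: sets_uniform_count_measure)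
    also have "\<dots> = (\<Sum>y\<in>S. ennreal (?f y) * indicator A y * ennreal (1 / card S))"
      using assms
      by (simp add: uniform_count_measure_def nn_integral_point_measure_finite ac_simps)
    also have "\<dots> = (\<Sum>y\<in>S. if y = x then indicator A x else 0)"
      using card by (intro sum.cong) (auto simp: indicator_def ennreal_mult[symmetric])
    also have "\<dots> = emeasure (return G x) A"
      using assms A by simp
    finally show "emeasure (density ?\<pi> ?f) A = emeasure (return G x) A" .
  qed (use assms in \<open>simp add: sets_uniform_count_measure\<close>)
  have "AE y in density ?\<pi> ?f. ln (?f y) = ln (real (card S))"
    by (subst AE_density) (auto simp: indicator_def split: if_splits)
  moreover have "integrable (density ?\<pi> ?f) (\<lambda>y. ln (real (card S)))"
    unfolding dens using assms space prob_space_return[of x G]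
    by (auto intro!: finite_measure.integrable_const prob_space.finite_measure)
  ultimately have "KL (density ?\<pi> ?f) ?\<pi> = ereal (\<integral>y. ln (real (card S)) \<partial>density ?\<pi> ?f)"
    by (intro KL_density_eq) auto
  moreover have "(\<integral>y. ln (real (card S)) \<partial>return G x) = ln (real (card S))"
    using assms space prob_space_return[of x G] prob_space.prob_space[of "return G x"] by simp
  ultimately show ?thesis by (simp add: dens)
qed

section \<open>Attainment of the minimum\<close>

lemma times_exp_neg_bound:
  fixes lam b x :: real
  assumes "lam > 0" "b \<ge> 0" "- b \<le> x"
  shows "\<bar>x\<bar> * exp (- (lam * x)) \<le> 1 / lam + b * exp (lam * b)"
proof (cases "x \<ge> 0")
  case True
  have "lam * x \<le> exp (lam * x)" using exp_ge_add_one_self[of "lam * x"] by linarith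
  then have "lam * x * exp (- (lam * x)) \<le> 1" by (simp add: exp_minus field_simps)
  then have "x * exp (- (lam * x)) \<le> 1 / lam" using assms by (simp add: field_simps)
  moreover have "0 \<le> b * exp (lam * b)" using assms by simp
  ultimately show ?thesis using True by simp
next
  case False
  have "lam * (- x) \<le> lam * b" using assms by (intro mult_left_mono) auto
  then have "\<bar>x\<bar> * exp (- (lam * x)) \<le> b * exp (lam * b)"
    using assms False by (intro mult_mono) auto
  moreover have "0 \<le> 1 / lam" using assms by simp
  ultimately show ?thesis by linarith
qed

text \<open>The lower bound makes the negative part integrable, so an expectation below \<infinity>
  is an ordinary integral of a function that is finite almost everywhere.\<close>

lemma ext_expectation_bounded_below:
  fixes f :: "'a \<Rightarrow> ereal"
  assumes "prob_space M" and [measurable]: "f \<in> borel_measurable M"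
    and c: "\<And>x. x \<in> space M \<Longrightarrow> ereal c \<le> f x"
    and fin: "ext_expectation M f < \<infinity>"
  shows "AE x in M. f x = ereal (real_of_ereal (f x))"
    and "integrable M (\<lambda>x. real_of_ereal (f x))"
    and "ext_expectation M f = ereal (\<integral>x. real_of_ereal (f x) \<partial>M)"
proof -
  interpret prob_space M by fact
  have "AE x in M. f x < \<infinity>"
    using fin by (rule AE_less_infty_of_ext_expectation) simp
  then show eq: "AE x in M. f x = ereal (real_of_ereal (f x))"
    using AE_space
  proof eventually_elim
    case (elim x)
    then show ?case using c[of x] by (cases "f x") auto
  qed
  have "(\<integral>\<^sup>+x. ennreal (real_of_ereal (f x)) \<partial>M) = (\<integral>\<^sup>+x. e2ennreal (f x) \<partial>M)"
    using eq by (intro nn_integral_cong_AE, eventually_elim) (metis e2ennreal_ereal)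
  moreover have "(\<integral>\<^sup>+x. ennreal (- real_of_ereal (f x)) \<partial>M) \<le> (\<integral>\<^sup>+x. ennreal \<bar>c\<bar> \<partial>M)"
    using eq AE_space[of M]
  proof (intro nn_integral_mono_AE, eventually_elim)
    case (elim x)
    then show ?case using c[of x] by (cases "f x") (auto intro!: ennreal_leI)
  qed
  ultimately show int: "integrable M (\<lambda>x. real_of_ereal (f x))"
    using pos_part_finite_of_ext_expectation[OF fin]
    by (intro integrableI_parts) (auto simp: emeasure_space_1 intro: le_less_trans)
  show "ext_expectation M f = ereal (\<integral>x. real_of_ereal (f x) \<partial>M)"
    using ext_expectation_cong_AE[OF eq] ext_expectation_integrable[OF int] by simp
qed

text \<open>The minimiser is the Gibbs measure with density proportional to \<open>exp (- lam * (l + D))\<close>, unless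
  \<open>D = \<infinity>\<close> almost everywhere, when the functional is constantly \<open>\<infinity>\<close>.\<close>

lemma gibbs_variational_minimiser:
  fixes l :: "'a \<Rightarrow> real" and D :: "'a \<Rightarrow> ereal" and lam c :: real
  assumes \<pi>: "\<pi> \<in> space (prob_algebra G)" and lam: "lam > 0"
    and [measurable]: "l \<in> borel_measurable G" "D \<in> borel_measurable G"
    and c: "\<And>g. g \<in> space G \<Longrightarrow> c \<le> l g" "\<And>g. g \<in> space G \<Longrightarrow> ereal c \<le> D g"
  defines "F \<equiv> \<lambda>\<rho>. ext_expectation \<rho> (\<lambda>g. ereal (l g)) + ext_expectation \<rho> D + KL \<rho> \<pi> / ereal lam"
  shows "\<exists>\<rho>\<^sub>0\<in>space (prob_algebra G). \<forall>\<rho>\<in>space (prob_algebra G). F \<rho>\<^sub>0 \<le> F \<rho>"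
proof -
  have "prob_space \<pi>" and sets_\<pi>[measurable_cong]: "sets \<pi> = sets G"
    using \<pi> by (auto simp: space_prob_algebra)
  then interpret \<pi>: prob_space \<pi> by simp
  have space_\<pi>: "space \<pi> = space G" using sets_\<pi> by (rule sets_eq_imp_space_eq)
  define d where "d g = real_of_ereal (D g)" for g
  have [measurable]: "d \<in> borel_measurable G" by (simp add: d_def[abs_def])
  define A where "A = {g \<in> space G. D g < \<infinity>}"
  have A[measurable]: "A \<in> sets G" by (simp add: A_def)
  have D_eq: "D g = ereal (d g)" if "g \<in> A" for g
    using that c(2)[of g] by (cases "D g") (auto simp: A_def d_def)
  have dc: "c \<le> d g" if "g \<in> A" for g
    using that c(2)[of g] D_eq[OF that] by (auto simp: A_def)
  \<comment> \<open>Off A, where D = \<infinity>, the real-valued d takes the default value 0. The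
    indicator restores the intended weight exp (-\<infinity>) = 0.\<close>
  define w where "w g = indicator A g * exp (- (lam * (l g + d g)))" for g
  have [measurable]: "w \<in> borel_measurable G" by (simp add: w_def[abs_def])
  have w_nonneg: "0 \<le> w g" for g by (simp add: w_def)
  have w_le: "w g \<le> exp (- (lam * (2 * c)))" for g
  proof (cases "g \<in> A")
    case True
    then have "2 * c \<le> l g + d g" using c(1)[of g] dc[of g] by (auto simp: A_def)
    with True lam show ?thesis by (simp add: w_def)
  qed (simp add: w_def)
  have w_int: "integrable \<pi> w"
    using w_le w_nonneg by (intro \<pi>.integrable_const_bound[where B="exp (- (lam * (2 * c)))"]) auto
  define Zc where "Zc = (\<integral>g. w g \<partial>\<pi>)"
  \<comment> \<open>In \<open>ereal\<close>, a sum with a summand \<infinity> is \<infinity>, so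
    \<open>F \<rho> < \<infinity>\<close> bounds each of the three summands away from \<infinity>.
    The lower bound c then turns both expectations into ordinary integrals.\<close>
  have finite_F: "F \<rho> < \<infinity> \<Longrightarrow> \<rho> \<in> space (prob_algebra G) \<Longrightarrow>
      KL \<rho> \<pi> < \<infinity> \<and> (AE g in \<rho>. g \<in> A) \<and> integrable \<rho> l \<and> integrable \<rho> d \<and>
      F \<rho> = ereal (\<integral>g. l g \<partial>\<rho>) + ereal (\<integral>g. d g \<partial>\<rho>) + KL \<rho> \<pi> / ereal lam" for \<rho>
  proof -
    assume fin: "F \<rho> < \<infinity>" and \<rho>: "\<rho> \<in> space (prob_algebra G)"
    have p: "prob_space \<rho>" and [measurable_cong]: "sets \<rho> = sets G"
      using \<rho> by (auto simp: space_prob_algebra)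
    have space_\<rho>: "space \<rho> = space G" using \<open>sets \<rho> = sets G\<close> by (rule sets_eq_imp_space_eq)
    have KL: "KL \<rho> \<pi> < \<infinity>" and el: "ext_expectation \<rho> (\<lambda>g. ereal (l g)) < \<infinity>"
      and eD: "ext_expectation \<rho> D < \<infinity>"
      using fin lam by (auto simp: F_def KL_def split: if_splits)
    note l = ext_expectation_bounded_below[OF p _ _ el, of c]
    note D = ext_expectation_bounded_below[OF p _ _ eD, of c]
    have "AE g in \<rho>. D g = ereal (d g)"
      using c(2) space_\<rho> unfolding d_def by (intro D(1)) auto
    then have "AE g in \<rho>. g \<in> A"
      using AE_space by eventually_elim (auto simp: A_def space_\<rho>)
    moreover have "integrable \<rho> l" using c(1) space_\<rho> l(2) by auto
    moreover have "integrable \<rho> d" unfolding d_def using c(2) space_\<rho> D(2) by auto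
    moreover have "ext_expectation \<rho> (\<lambda>g. ereal (l g)) = ereal (\<integral>g. l g \<partial>\<rho>)"
      using c(1) space_\<rho> l(3) by auto
    moreover have "ext_expectation \<rho> D = ereal (\<integral>g. d g \<partial>\<rho>)"
      unfolding d_def using c(2) space_\<rho> D(3) by auto
    ultimately show ?thesis using KL by (simp add: F_def)
  qed
  show ?thesis
  proof (cases "Zc = 0")
    \<comment> \<open>The weight w is positive on A, so D = \<infinity> almost everywhere under the
      prior. A finite divergence would carry this over to \<rho>, against the finite expectation of
      D. All values of F are thus \<infinity>, and the prior itself serves as minimiser.\<close>
    case True
    then have "AE g in \<pi>. w g = 0"
      unfolding Zc_def using w_int w_nonneg by (simp add: integral_nonneg_eq_0_iff_AE)
    then have null: "AE g in \<pi>. g \<notin> A"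
      by eventually_elim (auto simp: w_def indicator_def split: if_splits)
    have "F \<rho> = \<infinity>" if \<rho>: "\<rho> \<in> space (prob_algebra G)" for \<rho>
    proof (rule ccontr)
      assume "F \<rho> \<noteq> \<infinity>"
      with finite_F[of \<rho>] \<rho> have "KL \<rho> \<pi> < \<infinity>" and A: "AE g in \<rho>. g \<in> A"
        by (auto simp: less_top[symmetric])
      then have "absolutely_continuous \<pi> \<rho>" by (auto simp: KL_def split: if_splits)
      moreover have p: "prob_space \<rho>" and "sets \<rho> = sets \<pi>"
        using \<rho> sets_\<pi> by (auto simp: space_prob_algebra)
      ultimately have "AE g in \<rho>. g \<notin> A"
        using null by (intro absolutely_continuous_AE[of \<rho> \<pi>]) auto
      with A have "AE g in \<rho>. False" by eventually_elim simp
      then show False using prob_space.AE_False[OF p] by simp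
    qed
    then show ?thesis using \<pi> by auto
  next
    case False
    then have Z: "Zc > 0" using w_nonneg Bochner_Integration.integral_nonneg[of \<pi> w] unfolding Zc_def by fastforce
    define f where "f g = w g / Zc" for g
    have [measurable]: "f \<in> borel_measurable \<pi>" by (simp add: f_def[abs_def])
    have f_nonneg: "0 \<le> f g" for g using w_nonneg Z by (simp add: f_def)
    have f_int: "(\<integral>\<^sup>+g. ennreal (f g) \<partial>\<pi>) = 1"
      using w_int f_nonneg False
      by (subst nn_integral_eq_integral) (auto simp: f_def[abs_def] simp flip: Zc_def)
    define \<rho>\<^sub>0 where "\<rho>\<^sub>0 = density \<pi> f"
    have sets_\<rho>\<^sub>0[measurable_cong]: "sets \<rho>\<^sub>0 = sets G" by (simp add: \<rho>\<^sub>0_def sets_\<pi>)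
    have p0: "prob_space \<rho>\<^sub>0"
      using f_int by (intro prob_spaceI) (simp add: \<rho>\<^sub>0_def emeasure_density cong: nn_integral_cong)
    interpret \<rho>\<^sub>0: prob_space \<rho>\<^sub>0 by (rule p0)
    have \<rho>\<^sub>0: "\<rho>\<^sub>0 \<in> space (prob_algebra G)" using p0 sets_\<rho>\<^sub>0 by (simp add: space_prob_algebra)
    have A0: "AE g in \<rho>\<^sub>0. g \<in> A"
      unfolding \<rho>\<^sub>0_def
      by (subst AE_density) (auto simp: f_def w_def indicator_def split: if_splits)
    \<comment> \<open>On A, l + d is at least - 2 * \<bar>c\<bar>, and x exp (- lam * x) is bounded
      on such a half-line. The integrand is therefore bounded under the prior.\<close>
    have "integrable \<pi> (\<lambda>g. f g * (l g + d g))"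
    proof (rule \<pi>.integrable_const_bound)
      have "\<bar>f g * (l g + d g)\<bar> \<le> (1 / lam + 2 * \<bar>c\<bar> * exp (lam * (2 * \<bar>c\<bar>))) / Zc" (is "_ \<le> ?B") for g
      proof (cases "g \<in> A")
        case True
        have "\<bar>l g + d g\<bar> * exp (- (lam * (l g + d g))) \<le> 1 / lam + 2 * \<bar>c\<bar> * exp (lam * (2 * \<bar>c\<bar>))"
          using True c(1)[of g] dc[of g] lam by (intro times_exp_neg_bound) (auto simp: A_def)
        then show ?thesis
          using Z True by (simp add: f_def w_def abs_mult divide_right_mono mult.commute)
      next
        case False
        then show ?thesis using lam Z by (simp add: f_def w_def)
      qed
      then show "AE g in \<pi>. norm (f g * (l g + d g)) \<le> ?B" by simp
    qed simp
    then have int_ld: "integrable \<rho>\<^sub>0 (\<lambda>g. l g + d g)"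
      unfolding \<rho>\<^sub>0_def using f_nonneg by (subst integrable_real_density) auto
    \<comment> \<open>The common lower bound c prevents l and d from cancelling each other in l +
      d.\<close>
    have int_d: "integrable \<rho>\<^sub>0 d"
    proof (rule Bochner_Integration.integrable_bound)
      show "integrable \<rho>\<^sub>0 (\<lambda>g. \<bar>l g + d g\<bar> + 2 * \<bar>c\<bar>)" using int_ld by auto
      show "AE g in \<rho>\<^sub>0. norm (d g) \<le> norm (\<bar>l g + d g\<bar> + 2 * \<bar>c\<bar>)"
        using A0
      proof eventually_elim
        case (elim g)
        then show ?case using c(1)[of g] dc[of g] by (auto simp: A_def)
      qed
    qed simp
    have int_l: "integrable \<rho>\<^sub>0 l"
      using Bochner_Integration.integrable_diff[OF int_ld int_d] by simp
    \<comment> \<open>This is the logarithm of f on A. Its linear part cancels the two expectations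
      in F, which leaves the value - ln Zc / lam.\<close>
    let ?u = "\<lambda>g. - (lam * (l g + d g)) - ln Zc"
    have "KL \<rho>\<^sub>0 \<pi> = ereal (\<integral>g. ?u g \<partial>\<rho>\<^sub>0)"
      unfolding \<rho>\<^sub>0_def
    proof (rule \<pi>.KL_density_eq)
      show "integrable (density \<pi> f) ?u"
        unfolding \<rho>\<^sub>0_def[symmetric] using int_ld by auto
      show "AE g in density \<pi> f. ln (f g) = ?u g"
        unfolding \<rho>\<^sub>0_def[symmetric] using A0
        by eventually_elim (use Z in \<open>simp add: f_def w_def ln_div\<close>)
    qed (simp_all add: f_nonneg)
    also have "(\<integral>g. ?u g \<partial>\<rho>\<^sub>0) = - (lam * ((\<integral>g. l g \<partial>\<rho>\<^sub>0) + (\<integral>g. d g \<partial>\<rho>\<^sub>0))) - ln Zc"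
      using int_l int_d by (simp add: \<rho>\<^sub>0.prob_space)
    finally have KL0: "KL \<rho>\<^sub>0 \<pi> = ereal (- (lam * ((\<integral>g. l g \<partial>\<rho>\<^sub>0) + (\<integral>g. d g \<partial>\<rho>\<^sub>0))) - ln Zc)" .
    have "ext_expectation \<rho>\<^sub>0 D = ext_expectation \<rho>\<^sub>0 (\<lambda>g. ereal (d g))"
      using A0 by (intro ext_expectation_cong_AE, eventually_elim) (simp add: D_eq)
    then have F0: "F \<rho>\<^sub>0 = ereal (- ln Zc / lam)"
      using lam int_l int_d
      by (simp add: F_def KL0 ext_expectation_integrable field_simps)
    have "F \<rho>\<^sub>0 \<le> F \<rho>" if \<rho>: "\<rho> \<in> space (prob_algebra G)" for \<rho>
    proof (cases "F \<rho> < \<infinity>")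
      case True
      have p: "prob_space \<rho>" and [measurable_cong]: "sets \<rho> = sets G" and "sets \<rho> = sets \<pi>"
        using \<rho> sets_\<pi> by (auto simp: space_prob_algebra)
      interpret \<rho>: prob_space \<rho> by fact
      from finite_F[OF True \<rho>] have KL: "KL \<rho> \<pi> < \<infinity>" and A: "AE g in \<rho>. g \<in> A"
        and int: "integrable \<rho> l" "integrable \<rho> d"
        and F: "F \<rho> = ereal (\<integral>g. l g \<partial>\<rho>) + ereal (\<integral>g. d g \<partial>\<rho>) + KL \<rho> \<pi> / ereal lam"
        by auto
      \<comment> \<open>On A, f is exp (- ?h); off A it is 0. As f has integral 1 under the prior,
        Donsker-Varadhan with e = f gives the lower bound - ln Zc / lam for every
        competitor.\<close>
      let ?h = "\<lambda>g. lam * (l g + d g) + ln Zc"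
      have "AE g in \<rho>. ennreal (f g) = ennreal (exp (- ?h g))"
        using A
      proof eventually_elim
        case (elim g)
        have "exp (- ?h g) = exp (- (lam * (l g + d g))) / exp (ln Zc)"
          by (simp only: minus_add_distrib add_uminus_conv_diff exp_diff)
        with elim Z show ?case by (simp add: f_def w_def)
      qed
      then have "ereal (- (\<integral>g. ?h g \<partial>\<rho>)) \<le> KL \<rho> \<pi>"
        using KL int f_int
        by (intro donsker_varadhan[where e="\<lambda>g. ennreal (f g)"] p \<open>sets \<rho> = sets \<pi>\<close>
              \<pi>.prob_space_axioms) auto
      moreover obtain k where k: "KL \<rho> \<pi> = ereal k"
        using KL by (auto simp: KL_def split: if_splits)
      ultimately have "- (lam * ((\<integral>g. l g \<partial>\<rho>) + (\<integral>g. d g \<partial>\<rho>))) - ln Zc \<le> k"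
        using int by (simp add: \<rho>.prob_space)
      with lam show ?thesis by (simp add: F0 F k field_simps)
    qed simp
    with \<rho>\<^sub>0 show ?thesis by blast
  qed
qed

section \<open>The online SeqRand algorithm\<close>

text \<open>The assumption \<open>kernel\<close> is the implicit measurability of the next
  distribution in the past draws. It also makes that distribution a probability measure at points
  where the Gibbs normalising constant is infinite; there the Gibbs measure is zero and the online
  variance inequality says nothing.\<close>

locale seqrand_run =
  fixes Zs :: "'z set" and GB G \<pi> :: "'g measure"
    and L :: "'z \<Rightarrow> 'g \<Rightarrow> real" and \<delta> :: "'z \<Rightarrow> 'g \<Rightarrow> 'g \<Rightarrow> real"
    and lam :: real and n :: nat and Z :: "nat \<Rightarrow> 'z"
    and pihat :: "'g measure \<Rightarrow> 'g measure"
  assumes lam: "lam > 0"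
    and prior: "\<pi> \<in> space (prob_algebra G)"
    and L_GB: "\<And>z. z \<in> Zs \<Longrightarrow> L z \<in> borel_measurable GB"
    and L_G: "\<And>z. z \<in> Zs \<Longrightarrow> L z \<in> borel_measurable G"
    and delta: "\<And>z. z \<in> Zs \<Longrightarrow> (\<lambda>(g, g'). \<delta> z g g') \<in> borel_measurable (G \<Otimes>\<^sub>M GB)"
    and ovi: "online_variance_inequality Zs G GB L lam \<delta> pihat"
    and Z: "\<And>i. i \<in> {1..n} \<Longrightarrow> Z i \<in> Zs"
    and kernel: "\<And>i. i < n \<Longrightarrow>
                   seqrand_rho L lam \<delta> pihat \<pi> Z i \<in> PiM {0..<i} (\<lambda>_. GB) \<rightarrow>\<^sub>M prob_algebra GB"
begin

abbreviation "\<Omega> k \<equiv> PiM {0..<k} (\<lambda>_. GB)"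
abbreviation "rho \<equiv> seqrand_rho L lam \<delta> pihat \<pi> Z"
abbreviation "law \<equiv> seqrand_law GB L lam \<delta> pihat \<pi> Z"
abbreviation "S \<equiv> seqrand_S L \<delta> Z"

section \<open>The joint law of the draws, and measurability\<close>

lemma prob_space_prior: "prob_space \<pi>" and sets_prior: "sets \<pi> = sets G"
  using prior by (auto simp: space_prob_algebra)

sublocale \<pi>: prob_space \<pi> by (rule prob_space_prior)

lemma space_prior: "space \<pi> = space G"
  using sets_prior by (rule sets_eq_imp_space_eq)

lemma measurable_upd: "(\<lambda>(\<omega>, x). (fun_upd \<omega> k x)) \<in> \<Omega> k \<Otimes>\<^sub>M GB \<rightarrow>\<^sub>M \<Omega> (Suc k)"
  using measurable_add_dim[of k "{0..<k}" "\<lambda>_. GB"] by (simp add: atLeast0_lessThan_Suc)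

lemma law_kernel:
  assumes "k < n"
  shows "(\<lambda>\<omega>. distr (rho k \<omega>) (\<Omega> (Suc k)) (fun_upd \<omega> k)) \<in> \<Omega> k \<rightarrow>\<^sub>M prob_algebra (\<Omega> (Suc k))"
  by (rule measurable_distr_prob_space2[OF kernel[OF assms] measurable_upd])

lemma law_prob_algebra: "k \<le> n \<Longrightarrow> law k \<in> space (prob_algebra (\<Omega> k))"
proof (induction k)
  case 0
  show ?case
    by (auto simp: space_prob_algebra space_PiM intro!: prob_space_return)
next
  case (Suc k)
  then have "law k \<in> space (prob_algebra (\<Omega> k))" by simp
  \<comment> \<open>The bind rule concerns measurable maps into \<open>prob_algebra\<close>. It is
    applied to the constant map with value \<open>law k\<close> and evaluated at an arbitrary
    point.\<close>
  from measurable_space[OF measurable_bind_prob_space[OF measurable_const[OF this] law_kernel],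
      of undefined "count_space UNIV"]
  show ?case using Suc.prems by simp
qed

lemma prob_space_law: "k \<le> n \<Longrightarrow> prob_space (law k)"
  and sets_law: "k \<le> n \<Longrightarrow> sets (law k) = sets (\<Omega> k)"
  using law_prob_algebra[of k] by (auto simp: space_prob_algebra simp del: seqrand_law.simps)

lemma space_law: "k \<le> n \<Longrightarrow> space (law k) = space (\<Omega> k)"
  by (rule sets_eq_imp_space_eq) (rule sets_law)

lemma prob_space_rho: "k < n \<Longrightarrow> \<omega> \<in> space (\<Omega> k) \<Longrightarrow> prob_space (rho k \<omega>)"
  and sets_rho: "k < n \<Longrightarrow> \<omega> \<in> space (\<Omega> k) \<Longrightarrow> sets (rho k \<omega>) = sets GB"
  using measurable_space[OF kernel] by (auto simp: space_prob_algebra)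

lemma measurable_upd_rho:
  assumes "k < n" "\<omega> \<in> space (\<Omega> k)"
  shows "fun_upd \<omega> k \<in> rho k \<omega> \<rightarrow>\<^sub>M \<Omega> (Suc k)"
  using measurable_compose[OF measurable_Pair1'[OF assms(2)] measurable_upd]
  by (simp add: measurable_cong_sets[OF sets_rho[OF assms] refl])

text \<open>This is the one-step tower property. In its nonnegative form it can be used before any
  integrability is known.\<close>

lemma nn_integral_law_Suc:
  assumes k: "k < n" and f: "f \<in> borel_measurable (\<Omega> (Suc k))"
  shows "(\<integral>\<^sup>+\<omega>. f \<omega> \<partial>law (Suc k)) = (\<integral>\<^sup>+\<omega>. \<integral>\<^sup>+x. f (fun_upd \<omega> k x) \<partial>rho k \<omega> \<partial>law k)"
proof -
  have "(\<integral>\<^sup>+\<omega>. f \<omega> \<partial>law (Suc k)) =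
      (\<integral>\<^sup>+\<omega>. \<integral>\<^sup>+\<omega>'. f \<omega>' \<partial>distr (rho k \<omega>) (\<Omega> (Suc k)) (fun_upd \<omega> k) \<partial>law k)"
    using measurable_prob_algebraD[OF law_kernel[OF k]] sets_law[of k] k f
    by (simp add: nn_integral_bind[where B="\<Omega> (Suc k)"] cong: measurable_cong_sets)
  also have "\<dots> = (\<integral>\<^sup>+\<omega>. \<integral>\<^sup>+x. f (fun_upd \<omega> k x) \<partial>rho k \<omega> \<partial>law k)"
    using k f by (intro nn_integral_cong nn_integral_distr measurable_upd_rho) (auto simp: space_law)
  finally show ?thesis .
qed

lemma AE_law_Suc:
  assumes k: "k < n" and P: "Measurable.pred (\<Omega> (Suc k)) P"
  shows "(AE \<omega> in law (Suc k). P \<omega>) \<longleftrightarrow> (AE \<omega> in law k. AE x in rho k \<omega>. P (fun_upd \<omega> k x))"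
proof -
  have "(AE \<omega> in law (Suc k). P \<omega>) \<longleftrightarrow>
      (AE \<omega> in law k. AE \<omega>' in distr (rho k \<omega>) (\<Omega> (Suc k)) (fun_upd \<omega> k). P \<omega>')"
    unfolding seqrand_law.simps
    using measurable_prob_algebraD[OF law_kernel[OF k]] k
    by (intro AE_bind[OF _ P]) (simp add: measurable_cong_sets[OF sets_law refl])
  also have "\<dots> \<longleftrightarrow> (AE \<omega> in law k. AE x in rho k \<omega>. P (fun_upd \<omega> k x))"
    using k P by (intro AE_cong AE_distr_iff measurable_upd_rho) (auto simp: space_law)
  finally show ?thesis .
qed

lemma measurable_loss:
  assumes "i \<in> {1..k}" "k \<le> n"
  shows "(\<lambda>\<omega>. L (Z i) (\<omega> (i - 1))) \<in> borel_measurable (\<Omega> k)"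
  using assms measurable_compose[OF measurable_component_singleton[of "i - 1" "{0..<k}" "\<lambda>_. GB"]
    L_GB[OF Z, of i]] by auto

lemma measurable_delta:
  assumes "i \<in> {1..k}" "k \<le> n"
  shows "(\<lambda>(g, \<omega>). \<delta> (Z i) g (\<omega> (i - 1))) \<in> borel_measurable (G \<Otimes>\<^sub>M \<Omega> k)"
proof -
  have "(\<lambda>(g, \<omega>). (g, \<omega> (i - 1))) \<in> G \<Otimes>\<^sub>M \<Omega> k \<rightarrow>\<^sub>M G \<Otimes>\<^sub>M GB"
    using assms measurable_component_singleton[of "i - 1" "{0..<k}" "\<lambda>_. GB"]
    by (auto simp: split_beta' intro!: measurable_Pair measurable_compose[OF measurable_snd])
  from measurable_compose[OF this delta[OF Z]] assms show ?thesis
    by (simp add: split_beta')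
qed

lemma S_eq_sum: "S \<omega> k g = (\<Sum>i=1..k. L (Z i) g) + (\<Sum>i=1..k. \<delta> (Z i) g (\<omega> (i - 1)))"
  by (induction k) auto

text \<open>The score at time k involves only draws with index below k.\<close>

lemma S_upd: "S (fun_upd \<omega> k x) k g = S \<omega> k g"
  unfolding S_eq_sum by (intro arg_cong2[where f="(+)"] sum.cong) auto

lemma measurable_cum_loss: "(\<lambda>g. \<Sum>i=1..n. L (Z i) g) \<in> borel_measurable G"
  by (intro borel_measurable_sum L_G Z)

lemma measurable_cum_delta:
  "k \<le> n \<Longrightarrow> (\<lambda>(g, \<omega>). \<Sum>i=1..k. \<delta> (Z i) g (\<omega> (i - 1))) \<in> borel_measurable (G \<Otimes>\<^sub>M \<Omega> k)"
  unfolding split_beta' by (intro borel_measurable_sum measurable_delta[unfolded split_beta'])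

lemma measurable_S:
  assumes "k \<le> n"
  shows "(\<lambda>(g, \<omega>). S \<omega> k g) \<in> borel_measurable (G \<Otimes>\<^sub>M \<Omega> k)"
proof -
  have "(\<lambda>p. \<Sum>i=1..k. L (Z i) (fst p)) \<in> borel_measurable (G \<Otimes>\<^sub>M \<Omega> k)"
    using assms by (intro borel_measurable_sum measurable_compose[OF measurable_fst L_G] Z) auto
  with measurable_cum_delta[OF assms] show ?thesis
    by (auto simp: S_eq_sum split_beta')
qed

section \<open>Normalising constants and the supermartingale\<close>

definition W :: "nat \<Rightarrow> (nat \<Rightarrow> 'g) \<Rightarrow> ennreal" where
  "W k \<omega> = (\<integral>\<^sup>+g. ennreal (exp (- (lam * S \<omega> k g))) \<partial>\<pi>)"

text \<open>Nothing bounds the score from below, so \<open>W k \<omega>\<close> may be \<infinity>;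
  there the real value chosen by \<open>enn2real\<close> carries no meaning. By
  \<open>AE_W_finite\<close> this happens only on a null set of the law.\<close>

definition M :: "nat \<Rightarrow> (nat \<Rightarrow> 'g) \<Rightarrow> real" where
  "M k \<omega> = lam * (\<Sum>i=1..k. L (Z i) (\<omega> (i - 1))) + ln (enn2real (W k \<omega>))"

lemma measurable_W:
  assumes "k \<le> n"
  shows "W k \<in> borel_measurable (\<Omega> k)"
proof -
  have "(\<lambda>(\<omega>, g). S \<omega> k g) \<in> borel_measurable (\<Omega> k \<Otimes>\<^sub>M \<pi>)"
    using measurable_pair_swap[OF measurable_S[OF assms]]
    by (simp add: split_beta' measurable_cong_sets[OF sets_pair_measure_cong[OF refl sets_prior]])
  then show ?thesis
    unfolding W_def[abs_def] by (intro \<pi>.borel_measurable_nn_integral) (simp add: split_beta')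
qed

lemma measurable_M: "k \<le> n \<Longrightarrow> M k \<in> borel_measurable (\<Omega> k)"
  unfolding M_def[abs_def]
  by (intro borel_measurable_add borel_measurable_times borel_measurable_sum borel_measurable_ln
      borel_measurable_enn2real measurable_W measurable_loss borel_measurable_const)

lemma measurable_S_section:
  assumes "k \<le> n" "\<omega> \<in> space (\<Omega> k)"
  shows "S \<omega> k \<in> borel_measurable G"
  using measurable_compose[OF measurable_Pair2'[OF assms(2)] measurable_S[OF assms(1)]] by simp

lemma W_pos:
  assumes "k \<le> n" "\<omega> \<in> space (\<Omega> k)"
  shows "0 < W k \<omega>"
proof -
  have [measurable]: "S \<omega> k \<in> borel_measurable \<pi>"
    using measurable_S_section[OF assms] by (simp add: measurable_cong_sets[OF sets_prior refl])
  have "W k \<omega> \<noteq> 0"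
    by (simp add: W_def nn_integral_0_iff_AE)
  then show ?thesis by (simp add: zero_less_iff_neq_zero)
qed

lemma W_0: "W 0 \<omega> = 1"
  by (simp add: W_def \<pi>.emeasure_space_1)

text \<open>The score at time 0 is zero, and the Gibbs measure of a zero score is the prior. The
  initial draw thus follows the same rule as all later ones.\<close>

lemma rho_eq: "rho k \<omega> = pihat (gibbs \<pi> (\<lambda>g. lam * S \<omega> k g))"
  by (auto simp: seqrand_rho_def gibbs_def \<pi>.emeasure_space_1 density_1)

lemma gibbs_prob_algebra:
  assumes "k \<le> n" "\<omega> \<in> space (\<Omega> k)" and fin: "W k \<omega> < \<infinity>"
  shows "gibbs \<pi> (\<lambda>g. lam * S \<omega> k g) \<in> space (prob_algebra G)"
proof -
  have [measurable]: "S \<omega> k \<in> borel_measurable \<pi>"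
    using measurable_S_section[OF assms(1,2)] by (simp add: measurable_cong_sets[OF sets_prior refl])
  have "(\<integral>\<^sup>+g. ennreal (exp (- (lam * S \<omega> k g))) / W k \<omega> \<partial>\<pi>) = W k \<omega> / W k \<omega>"
    by (simp add: nn_integral_divide W_def)
  also have "\<dots> = 1"
    using W_pos[OF assms(1,2)] fin by (intro ennreal_divide_self) auto
  finally have "prob_space (gibbs \<pi> (\<lambda>g. lam * S \<omega> k g))"
    by (intro prob_spaceI)
       (simp add: gibbs_def emeasure_density W_def[symmetric] cong: nn_integral_cong)
  then show ?thesis
    by (simp add: space_prob_algebra gibbs_def sets_prior)
qed

text \<open>Up to the factor \<open>exp (lam * L z x)\<close>, the inner expectation of the online variance inequality is
  the quotient \<open>W (Suc k) / W k\<close>.\<close>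

lemma
  assumes k: "k < n" and \<omega>: "\<omega> \<in> space (\<Omega> k)" and fin: "W k \<omega> < \<infinity>"
  shows W_Suc_finite: "AE x in rho k \<omega>. W (Suc k) (fun_upd \<omega> k x) < \<infinity>"
    and M_step_pos_part: "(\<integral>\<^sup>+x. ennreal (M (Suc k) (fun_upd \<omega> k x) - M k \<omega>) \<partial>rho k \<omega>) < \<infinity>"
    and M_step_le: "(\<integral>\<^sup>+x. ennreal (M (Suc k) (fun_upd \<omega> k x) - M k \<omega>) \<partial>rho k \<omega>)
                      \<le> (\<integral>\<^sup>+x. ennreal (M k \<omega> - M (Suc k) (fun_upd \<omega> k x)) \<partial>rho k \<omega>)"
proof -
  define z where "z = Z (Suc k)"
  define f where "f x = ext_ln (\<integral>\<^sup>+g. ennreal (exp (lam * (L z x - L z g - \<delta> z g x)))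
                      \<partial>gibbs \<pi> (\<lambda>g. lam * S \<omega> k g))" for x
  have "z \<in> Zs" using k by (auto simp: z_def intro: Z)
  then have "ext_expectation (rho k \<omega>) f \<le> 0"
    using ovi gibbs_prob_algebra[OF _ \<omega> fin] k
    unfolding online_variance_inequality_def rho_eq f_def by simp
  moreover from this have pos: "(\<integral>\<^sup>+x. e2ennreal (f x) \<partial>rho k \<omega>) < \<infinity>"
    by (intro pos_part_finite_of_ext_expectation) (auto intro: le_less_trans)
  \<comment> \<open>Since the positive part is finite, comparing the two parts is legitimate, even
    if the negative part is infinite.\<close>
  ultimately have le: "(\<integral>\<^sup>+x. e2ennreal (f x) \<partial>rho k \<omega>) \<le> (\<integral>\<^sup>+x. e2ennreal (- f x) \<partial>rho k \<omega>)"
    by (cases "\<integral>\<^sup>+x. e2ennreal (f x) \<partial>rho k \<omega>"; cases "\<integral>\<^sup>+x. e2ennreal (- f x) \<partial>rho k \<omega>")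
       (auto simp: ext_expectation_def enn2ereal_ennreal)
  have [measurable]: "S \<omega> k \<in> borel_measurable \<pi>"
    using measurable_S_section[of k \<omega>] k \<omega> by (simp add: measurable_cong_sets[OF sets_prior refl])
  obtain w where w: "W k \<omega> = ennreal w" "0 < w"
    using W_pos[of k \<omega>] k \<omega> fin by (cases "W k \<omega>") (auto simp: ennreal_zero_less_top)
  have f_eq: "f x = ext_ln (ennreal (exp (lam * L z x) / w) * W (Suc k) (fun_upd \<omega> k x))"
    if x: "x \<in> space GB" for x
  proof -
    have \<omega>': "(fun_upd \<omega> k x) \<in> space (\<Omega> (Suc k))"
      using measurable_space[OF measurable_upd, of "(\<omega>, x)"] \<omega> x by (simp add: space_pair_measure)
    have [measurable]: "S (fun_upd \<omega> k x) (Suc k) \<in> borel_measurable \<pi>"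
      using measurable_S_section[OF _ \<omega>'] k
      by (simp add: measurable_cong_sets[OF sets_prior refl] del: seqrand_S.simps)
    have [measurable]: "L z \<in> borel_measurable \<pi>"
      using L_G[OF \<open>z \<in> Zs\<close>] by (simp add: measurable_cong_sets[OF sets_prior refl])
    have "(\<lambda>g. \<delta> z g x) \<in> borel_measurable G"
      using measurable_compose[OF measurable_Pair2'[OF x] delta[OF \<open>z \<in> Zs\<close>]] by simp
    then have [measurable]: "(\<lambda>g. \<delta> z g x) \<in> borel_measurable \<pi>"
      by (simp add: measurable_cong_sets[OF sets_prior refl])
    have "(\<integral>\<^sup>+g. ennreal (exp (lam * (L z x - L z g - \<delta> z g x))) \<partial>gibbs \<pi> (\<lambda>g. lam * S \<omega> k g))
        = (\<integral>\<^sup>+g. ennreal (exp (- (lam * S \<omega> k g))) / W k \<omega> *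
              ennreal (exp (lam * (L z x - L z g - \<delta> z g x))) \<partial>\<pi>)"
      unfolding gibbs_def W_def[symmetric] by (intro nn_integral_density) auto
    also have "\<dots> = (\<integral>\<^sup>+g. ennreal (exp (lam * L z x) / w) *
                      ennreal (exp (- (lam * S (fun_upd \<omega> k x) (Suc k) g))) \<partial>\<pi>)"
    proof (intro nn_integral_cong)
      fix g
      have "exp (- (lam * S \<omega> k g)) / w * exp (lam * (L z x - L z g - \<delta> z g x)) =
          exp (lam * L z x) / w * exp (- (lam * S (fun_upd \<omega> k x) (Suc k) g))"
        by (simp add: S_upd z_def mult_exp_exp algebra_simps)
      then show "ennreal (exp (- (lam * S \<omega> k g))) / W k \<omega> *
            ennreal (exp (lam * (L z x - L z g - \<delta> z g x))) =
          ennreal (exp (lam * L z x) / w) * ennreal (exp (- (lam * S (fun_upd \<omega> k x) (Suc k) g)))"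
        using w by (simp only: w(1) divide_ennreal exp_ge_zero ennreal_mult[symmetric] divide_nonneg_pos)
    qed
    also have "\<dots> = ennreal (exp (lam * L z x) / w) * W (Suc k) (fun_upd \<omega> k x)"
      unfolding W_def by (intro nn_integral_cmult) measurable
    finally show ?thesis by (simp only: f_def)
  qed
  have upd: "fun_upd \<omega> k \<in> rho k \<omega> \<rightarrow>\<^sub>M \<Omega> (Suc k)"
    by (rule measurable_upd_rho[OF k \<omega>])
  have space_rho: "space (rho k \<omega>) = space GB"
    using sets_rho[OF k \<omega>] by (rule sets_eq_imp_space_eq)
  have [measurable]: "(\<lambda>x. W (Suc k) (fun_upd \<omega> k x)) \<in> borel_measurable (rho k \<omega>)"
    using measurable_compose[OF upd measurable_W] k by simp
  have [measurable]: "L z \<in> borel_measurable (rho k \<omega>)"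
    using L_GB[OF \<open>z \<in> Zs\<close>] sets_rho[OF k \<omega>] by (simp cong: measurable_cong_sets)
  have "(\<lambda>x. ext_ln (ennreal (exp (lam * L z x) / w) * W (Suc k) (fun_upd \<omega> k x)))
      \<in> borel_measurable (rho k \<omega>)"
    unfolding ext_ln_def by measurable
  then have "f \<in> borel_measurable (rho k \<omega>)"
    by (rule measurable_cong[THEN iffD1, rotated]) (simp add: f_eq space_rho)
  \<comment> \<open>\<open>ext_ln\<close> is \<infinity> at \<infinity>, so almost sure finiteness
    of f excludes an infinite normalising constant after the next draw.\<close>
  then have "AE x in rho k \<omega>. e2ennreal (f x) \<noteq> \<infinity>"
    using pos by (intro nn_integral_PInf_AE) auto
  then show W_fin: "AE x in rho k \<omega>. W (Suc k) (fun_upd \<omega> k x) < \<infinity>"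
    using AE_space
  proof eventually_elim
    case (elim x)
    then show ?case
      using w by (auto simp: f_eq space_rho ext_ln_def ennreal_mult_top less_top[symmetric])
  qed
  have f_M: "AE x in rho k \<omega>. f x = ereal (M (Suc k) (fun_upd \<omega> k x) - M k \<omega>)"
    using W_fin AE_space
  proof eventually_elim
    case (elim x)
    have \<omega>': "(fun_upd \<omega> k x) \<in> space (\<Omega> (Suc k))"
      using measurable_space[OF upd] elim by simp
    obtain w' where w': "W (Suc k) (fun_upd \<omega> k x) = ennreal w'" "0 < w'"
      using W_pos[OF _ \<omega>'] k elim by (cases "W (Suc k) (fun_upd \<omega> k x)") (auto simp: ennreal_zero_less_top)
    have "f x = ext_ln (ennreal (exp (lam * L z x) / w * w'))"
      using elim w w' by (simp add: f_eq space_rho ennreal_mult[symmetric])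
    also have "\<dots> = ereal (lam * L z x - ln w + ln w')"
      using w w' by (simp add: ext_ln_def ln_mult ln_div ennreal_eq_0_iff not_le)
    \<comment> \<open>The losses of the first k rounds do not see the draw with index k and cancel,
      which leaves the loss of the new draw.\<close>
    also have "lam * L z x - ln w + ln w' = M (Suc k) (fun_upd \<omega> k x) - M k \<omega>"
    proof -
      have "(\<Sum>i=1..k. L (Z i) ((fun_upd \<omega> k x) (i - 1))) = (\<Sum>i=1..k. L (Z i) (\<omega> (i - 1)))"
        by (intro sum.cong) auto
      then show ?thesis
        using w w' by (simp add: M_def z_def algebra_simps)
    qed
    finally show ?case .
  qed
  have eqs: "(\<integral>\<^sup>+x. e2ennreal (f x) \<partial>rho k \<omega>) = (\<integral>\<^sup>+x. ennreal (M (Suc k) (fun_upd \<omega> k x) - M k \<omega>) \<partial>rho k \<omega>)"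
      "(\<integral>\<^sup>+x. e2ennreal (- f x) \<partial>rho k \<omega>) = (\<integral>\<^sup>+x. ennreal (M k \<omega> - M (Suc k) (fun_upd \<omega> k x)) \<partial>rho k \<omega>)"
    using f_M by (auto intro!: nn_integral_cong_AE)
  show "(\<integral>\<^sup>+x. ennreal (M (Suc k) (fun_upd \<omega> k x) - M k \<omega>) \<partial>rho k \<omega>) < \<infinity>"
    and "(\<integral>\<^sup>+x. ennreal (M (Suc k) (fun_upd \<omega> k x) - M k \<omega>) \<partial>rho k \<omega>)
      \<le> (\<integral>\<^sup>+x. ennreal (M k \<omega> - M (Suc k) (fun_upd \<omega> k x)) \<partial>rho k \<omega>)"
    using pos le by (simp_all only: eqs)
qed

text \<open>The online variance inequality at step k applies because \<open>W k\<close> is finite,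
  and it yields finiteness of \<open>W (Suc k)\<close>. So almost surely every Gibbs measure met by
  the algorithm is a probability measure.\<close>

lemma AE_W_finite: "k \<le> n \<Longrightarrow> AE \<omega> in law k. W k \<omega> < \<infinity>"
proof (induction k)
  case 0
  show ?case by (simp add: W_0)
next
  case (Suc k)
  have [measurable]: "W (Suc k) \<in> borel_measurable (\<Omega> (Suc k))" by (rule measurable_W) fact
  have "AE \<omega> in law k. W k \<omega> < \<infinity>" using Suc by simp
  then have "AE \<omega> in law k. AE x in rho k \<omega>. W (Suc k) (fun_upd \<omega> k x) < \<infinity>"
    using AE_space[of "law k"]
  proof eventually_elim
    case (elim \<omega>)
    with Suc.prems show ?case by (intro W_Suc_finite) (auto simp: space_law)
  qed
  then show ?case
    using Suc.prems by (subst AE_law_Suc) auto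
qed

text \<open>The increments of \<open>M\<close> have nonpositive conditional expectation, but need not be integrable. As for
  local supermartingales, integrability of the final negative part makes up for this: it passes to
  all earlier negative parts.\<close>

lemma M_supermartingale:
  assumes "k \<le> n" "(\<integral>\<^sup>+\<omega>. ennreal (- M k \<omega>) \<partial>law k) < \<infinity>"
  shows "integrable (law k) (M k) \<and> (\<integral>\<omega>. M k \<omega> \<partial>law k) \<le> 0"
  using assms
proof (induction k)
  case 0
  have "M 0 = (\<lambda>_. 0)" by (simp add: fun_eq_iff M_def W_0)
  then show ?case by (simp del: seqrand_law.simps)
next
  case (Suc k)
  then have k: "k < n" by simp
  have mM: "M k \<in> borel_measurable (law k)"
    using measurable_M[of k] k by (simp add: measurable_cong_sets[OF sets_law refl])
  have mM': "M (Suc k) \<in> borel_measurable (\<Omega> (Suc k))"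
    using measurable_M[of "Suc k"] k by simp
  define a where "a \<omega> = (\<integral>\<^sup>+x. ennreal (M (Suc k) (fun_upd \<omega> k x)) \<partial>rho k \<omega>)" for \<omega>
  define b where "b \<omega> = (\<integral>\<^sup>+x. ennreal (- M (Suc k) (fun_upd \<omega> k x)) \<partial>rho k \<omega>)" for \<omega>
  have int_a: "(\<integral>\<^sup>+\<omega>. ennreal (M (Suc k) \<omega>) \<partial>law (Suc k)) = (\<integral>\<^sup>+\<omega>. a \<omega> \<partial>law k)"
    unfolding a_def using k mM' by (intro nn_integral_law_Suc) auto
  have int_b: "(\<integral>\<^sup>+\<omega>. ennreal (- M (Suc k) \<omega>) \<partial>law (Suc k)) = (\<integral>\<^sup>+\<omega>. b \<omega> \<partial>law k)"
    unfolding b_def using k mM' by (intro nn_integral_law_Suc) auto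
  have kern: "rho k \<in> law k \<rightarrow>\<^sub>M subprob_algebra GB"
    using measurable_prob_algebraD[OF kernel[OF k]] k
    by (simp add: measurable_cong_sets[OF sets_law refl])
  have [measurable]: "(\<lambda>(\<omega>, x). M (Suc k) (fun_upd \<omega> k x)) \<in> borel_measurable (law k \<Otimes>\<^sub>M GB)"
    using measurable_compose[OF measurable_upd mM'] k
    by (simp add: split_beta' measurable_cong_sets[OF sets_pair_measure_cong[OF sets_law refl] refl])
  have [measurable]: "a \<in> borel_measurable (law k)" "b \<in> borel_measurable (law k)"
    unfolding a_def b_def
    by (intro nn_integral_measurable_subprob_algebra2[OF _ kern]; measurable)+
  have b_fin: "(\<integral>\<^sup>+\<omega>. b \<omega> \<partial>law k) < \<infinity>" using Suc.prems(2) unfolding int_b .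
  then have "AE \<omega> in law k. b \<omega> \<noteq> \<infinity>" by (intro nn_integral_PInf_AE) auto
  moreover have "AE \<omega> in law k. W k \<omega> < \<infinity>" using AE_W_finite k by simp
  \<comment> \<open>This is the conditional inequality a - b \<le> M k, rearranged into a form
    without subtraction, so that it can be integrated in \<open>ennreal\<close>.\<close>
  ultimately have ab: "AE \<omega> in law k. a \<omega> + ennreal (- M k \<omega>) \<le> b \<omega> + ennreal (M k \<omega>)"
    using AE_space[of "law k"]
  proof eventually_elim
    case (elim \<omega>)
    have \<omega>: "\<omega> \<in> space (\<Omega> k)" using elim k by (simp add: space_law)
    interpret R: prob_space "rho k \<omega>" by (rule prob_space_rho[OF k \<omega>])
    let ?F = "\<lambda>x. M (Suc k) (fun_upd \<omega> k x)"
    let ?V = "\<lambda>x. ?F x - M k \<omega>"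
    have [measurable]: "?F \<in> borel_measurable (rho k \<omega>)"
      using measurable_compose[OF measurable_upd_rho[OF k \<omega>] mM'] .
    have "(\<integral>\<^sup>+x. ennreal (- ?V x) \<partial>rho k \<omega>) \<le> (\<integral>\<^sup>+x. ennreal (- ?F x) + ennreal \<bar>M k \<omega>\<bar> \<partial>rho k \<omega>)"
    \<comment> \<open>Given \<omega>, the value \<open>M k \<omega>\<close> is a constant, so the
      negative part of the increment is controlled by that of \<open>M (Suc k)\<close>.\<close>
    proof (intro nn_integral_mono)
      fix x
      have "ennreal (- ?V x) \<le> ennreal (max 0 (- ?F x) + \<bar>M k \<omega>\<bar>)"
        by (intro ennreal_leI) auto
      then show "ennreal (- ?V x) \<le> ennreal (- ?F x) + ennreal \<bar>M k \<omega>\<bar>"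
        by (simp add: ennreal_plus)
    qed
    also have "\<dots> < \<infinity>"
      using elim(1) by (simp add: nn_integral_add R.emeasure_space_1 b_def less_top[symmetric])
    finally have neg: "(\<integral>\<^sup>+x. ennreal (- ?V x) \<partial>rho k \<omega>) < \<infinity>" .
    then have V: "integrable (rho k \<omega>) ?V"
      using M_step_pos_part[OF k \<omega> elim(2)] by (intro integrableI_parts) auto
    have "enn2real (\<integral>\<^sup>+x. ennreal (?V x) \<partial>rho k \<omega>) \<le> enn2real (\<integral>\<^sup>+x. ennreal (- ?V x) \<partial>rho k \<omega>)"
      using M_step_le[OF k \<omega> elim(2)] neg by (intro enn2real_mono) auto
    then have V_le: "(\<integral>x. ?V x \<partial>rho k \<omega>) \<le> 0"
      using V by (simp add: real_lebesgue_integral_def)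
    have F: "integrable (rho k \<omega>) ?F"
      using Bochner_Integration.integrable_add[OF V, of "\<lambda>_. M k \<omega>"] by simp
    have "(\<integral>x. ?F x \<partial>rho k \<omega>) \<le> M k \<omega>"
      using V_le F by (simp add: R.prob_space)
    moreover obtain a' b' where "a \<omega> = ennreal a'" "b \<omega> = ennreal b'" "0 \<le> a'" "0 \<le> b'"
        "(\<integral>x. ?F x \<partial>rho k \<omega>) = a' - b'"
      unfolding a_def b_def using integrable_real_parts[OF F] .
    ultimately have "a' - b' \<le> M k \<omega>" by simp
    then have "ennreal (a' + max 0 (- M k \<omega>)) \<le> ennreal (b' + max 0 (M k \<omega>))"
      by (intro ennreal_leI) auto
    then show ?case
      using \<open>a \<omega> = ennreal a'\<close> \<open>b \<omega> = ennreal b'\<close> \<open>0 \<le> a'\<close> \<open>0 \<le> b'\<close>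
      by (simp add: ennreal_plus)
  qed
  have "(\<integral>\<^sup>+\<omega>. ennreal (- M k \<omega>) \<partial>law k) \<le> (\<integral>\<^sup>+\<omega>. b \<omega> \<partial>law k)"
  \<comment> \<open>Where M k \<le> 0, the inequality \<open>ab\<close> reduces to a + (- M k) \<le>
    b. This is how the integrable negative part moves one step back in time.\<close>
  proof (intro nn_integral_mono_AE, use ab in eventually_elim)
    case (elim \<omega>)
    show ?case
    proof (cases "M k \<omega> \<le> 0")
      case True
      then show ?thesis using elim order_trans[OF add_increasing[OF zero_le order_refl] elim]
        by (simp add: ennreal_neg)
    qed (simp add: ennreal_neg)
  qed
  with b_fin have M_neg: "(\<integral>\<^sup>+\<omega>. ennreal (- M k \<omega>) \<partial>law k) < \<infinity>" by (rule le_less_trans[rotated])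
  with Suc.IH k have IH: "integrable (law k) (M k)" "(\<integral>\<omega>. M k \<omega> \<partial>law k) \<le> 0" by auto
  obtain p q where pq: "(\<integral>\<^sup>+\<omega>. ennreal (M k \<omega>) \<partial>law k) = ennreal p"
      "(\<integral>\<^sup>+\<omega>. ennreal (- M k \<omega>) \<partial>law k) = ennreal q" "0 \<le> p" "0 \<le> q"
      "(\<integral>\<omega>. M k \<omega> \<partial>law k) = p - q"
    using integrable_real_parts[OF IH(1)] .
  then have "p \<le> q" using IH by simp
  have "(\<integral>\<^sup>+\<omega>. a \<omega> + ennreal (- M k \<omega>) \<partial>law k) \<le> (\<integral>\<^sup>+\<omega>. b \<omega> + ennreal (M k \<omega>) \<partial>law k)"
    using ab by (rule nn_integral_mono_AE)
  then have le: "(\<integral>\<^sup>+\<omega>. a \<omega> \<partial>law k) + ennreal q \<le> (\<integral>\<^sup>+\<omega>. b \<omega> \<partial>law k) + ennreal p"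
    using mM by (simp add: nn_integral_add pq)
  obtain b' where b': "(\<integral>\<^sup>+\<omega>. b \<omega> \<partial>law k) = ennreal b'" "0 \<le> b'"
    using b_fin by (cases "\<integral>\<^sup>+\<omega>. b \<omega> \<partial>law k") auto
  obtain a' where a': "(\<integral>\<^sup>+\<omega>. a \<omega> \<partial>law k) = ennreal a'" "0 \<le> a'"
    using le b' pq by (cases "\<integral>\<^sup>+\<omega>. a \<omega> \<partial>law k") (auto simp: ennreal_plus[symmetric] top_unique simp del: ennreal_plus)
  have "a' \<le> b'"
    using le \<open>p \<le> q\<close> a' b' pq by (simp add: ennreal_plus[symmetric] del: ennreal_plus)
  have "M (Suc k) \<in> borel_measurable (law (Suc k))"
    using mM' sets_law[OF Suc.prems(1)] by (simp cong: measurable_cong_sets del: seqrand_law.simps)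
  then have "integrable (law (Suc k)) (M (Suc k))"
    using int_a int_b a' b' by (intro integrableI_parts) auto
  moreover from this have "(\<integral>\<omega>. M (Suc k) \<omega> \<partial>law (Suc k)) \<le> 0"
    using int_a int_b a' b' \<open>a' \<le> b'\<close> by (simp add: real_lebesgue_integral_def del: seqrand_law.simps)
  ultimately show ?case ..
qed

section \<open>The bound for one distribution on the model\<close>

lemma measurable_expected_cum_delta: "expected_cum_delta (law n) \<delta> Z n \<in> borel_measurable G"
proof -
  interpret P: prob_space "law n" by (rule prob_space_law) simp
  have [measurable]: "(\<lambda>(g, \<omega>). \<Sum>i=1..n. \<delta> (Z i) g (\<omega> (i - 1))) \<in> borel_measurable (G \<Otimes>\<^sub>M law n)"
    using measurable_cum_delta[of n]
    by (simp add: measurable_cong_sets[OF sets_pair_measure_cong[OF refl sets_law]])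
  show ?thesis
    unfolding expected_cum_delta_def[abs_def] ext_expectation_def by measurable
qed

text \<open>This treats the first alternative of \<open>cum_loss_exists\<close>. Only a bound below
  \<infinity> needs an argument; such a bound makes the divergence finite and the positive parts of
  l and D integrable, which starts the chain of integrability statements.\<close>

lemma expected_loss_le_bound:
  assumes \<rho>: "\<rho> \<in> space (prob_algebra G)"
    and neg: "\<And>i. i \<in> {1..n} \<Longrightarrow> (\<integral>\<^sup>+\<omega>. ennreal (- L (Z i) (\<omega> (i - 1))) \<partial>law n) < \<infinity>"
  shows "expected_cum_loss (law n) L Z n \<le> seqrand_bound (law n) L lam \<delta> \<pi> Z n \<rho>"
proof (cases "seqrand_bound (law n) L lam \<delta> \<pi> Z n \<rho> < \<infinity>")
  case True
  define P where "P = law n"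
  define D where "D = expected_cum_delta P \<delta> Z n"
  define \<Lambda> where "\<Lambda> \<omega> = (\<Sum>i=1..n. L (Z i) (\<omega> (i - 1)))" for \<omega>
  define l where "l g = (\<Sum>i=1..n. L (Z i) g)" for g
  define \<Delta> where "\<Delta> g \<omega> = (\<Sum>i=1..n. \<delta> (Z i) g (\<omega> (i - 1)))" for g \<omega>
  \<comment> \<open>Where W n is finite, Y is minus the logarithm of the density of the Gibbs
    measure at time n with respect to the prior.\<close>
  define Y where "Y g \<omega> = lam * (l g + \<Delta> g \<omega>) + ln (enn2real (W n \<omega>))" for g \<omega>
  have p\<rho>: "prob_space \<rho>" and sets_\<rho>: "sets \<rho> = sets G" and sets_\<rho>\<pi>: "sets \<rho> = sets \<pi>"
    using \<rho> sets_prior by (auto simp: space_prob_algebra)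
  have sets_P: "sets P = sets (\<Omega> n)" and pP: "prob_space P"
    unfolding P_def by (rule sets_law[OF order_refl], rule prob_space_law[OF order_refl])
  note [measurable_cong] = sets_\<rho> sets_P sets_prior
  interpret \<rho>: prob_space \<rho> by fact
  interpret P: prob_space P by fact
  interpret \<rho>P: pair_prob_space \<rho> P by unfold_locales
  have space_\<rho>: "space \<rho> = space G" and space_P: "space P = space (\<Omega> n)"
    using sets_\<rho> sets_P by (auto dest: sets_eq_imp_space_eq)
  have KL: "KL \<rho> \<pi> < \<infinity>" and el: "ext_expectation \<rho> (\<lambda>g. ereal (l g)) < \<infinity>"
    and eD: "ext_expectation \<rho> D < \<infinity>"
    using True lam by (auto simp: seqrand_bound_def KL_def l_def D_def P_def split: if_splits)

  have [measurable]: "l \<in> borel_measurable G"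
    unfolding l_def[abs_def] by (rule measurable_cum_loss)
  have [measurable]: "D \<in> borel_measurable G"
    unfolding D_def P_def by (rule measurable_expected_cum_delta)
  have \<Delta>_meas[measurable]: "(\<lambda>(g, \<omega>). \<Delta> g \<omega>) \<in> borel_measurable (G \<Otimes>\<^sub>M P)"
    using measurable_cum_delta[of n] unfolding \<Delta>_def[abs_def]
    by (simp add: measurable_cong_sets[OF sets_pair_measure_cong[OF refl sets_P]])
  have [measurable]: "W n \<in> borel_measurable P" "M n \<in> borel_measurable P"
    using measurable_W[of n] measurable_M[of n] by (simp_all add: measurable_cong_sets[OF sets_P])
  have L_meas: "(\<lambda>\<omega>. L (Z i) (\<omega> (i - 1))) \<in> borel_measurable P" if "i \<in> {1..n}" for i
    using measurable_loss[OF that] by (simp add: measurable_cong_sets[OF sets_P])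
  have [measurable]: "\<Lambda> \<in> borel_measurable P"
    unfolding \<Lambda>_def[abs_def] by (intro borel_measurable_sum L_meas)
  have Y_meas[measurable]: "(\<lambda>(g, \<omega>). Y g \<omega>) \<in> borel_measurable (G \<Otimes>\<^sub>M P)"
    unfolding Y_def[abs_def] by measurable
  have Y_section[measurable]: "Y g \<in> borel_measurable P" and
    \<Delta>_section[measurable]: "\<Delta> g \<in> borel_measurable P" if "g \<in> space G" for g
    using measurable_compose[OF measurable_Pair1'[OF that] Y_meas]
      measurable_compose[OF measurable_Pair1'[OF that] \<Delta>_meas] by simp_all

  have Y_exp: "AE \<omega> in P. (\<integral>\<^sup>+g. ennreal (exp (- Y g \<omega>)) \<partial>\<pi>) = 1"
    using AE_W_finite[OF order_refl] AE_space unfolding P_def[symmetric]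
  proof eventually_elim
    case (elim \<omega>)
    then have \<omega>: "\<omega> \<in> space (\<Omega> n)" by (simp add: space_P)
    obtain w where w: "W n \<omega> = ennreal w" "0 < w"
      using W_pos[OF order_refl \<omega>] elim by (cases "W n \<omega>") (auto simp: ennreal_zero_less_top)
    have [measurable]: "S \<omega> n \<in> borel_measurable \<pi>"
      using measurable_S_section[OF order_refl \<omega>] by (simp add: measurable_cong_sets[OF sets_prior refl])
    have "(\<integral>\<^sup>+g. ennreal (exp (- Y g \<omega>)) \<partial>\<pi>) = (\<integral>\<^sup>+g. ennreal (exp (- (lam * S \<omega> n g))) / W n \<omega> \<partial>\<pi>)"
    proof (intro nn_integral_cong)
      fix g
      have "exp (- Y g \<omega>) = exp (- (lam * S \<omega> n g)) / w"
        using w by (simp add: Y_def l_def \<Delta>_def S_eq_sum exp_diff)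
      with w show "ennreal (exp (- Y g \<omega>)) = ennreal (exp (- (lam * S \<omega> n g))) / W n \<omega>"
        by (simp add: divide_ennreal)
    qed
    also have "\<dots> = W n \<omega> / W n \<omega>"
      by (simp add: nn_integral_divide W_def)
    also have "\<dots> = 1" using w by (simp add: ennreal_divide_self)
    finally show ?case .
  qed
  \<comment> \<open>The constant is independent of \<omega>. Hence the negative part of Y has a
    finite double integral, whose order may be exchanged without further integrability.\<close>
  let ?C = "(\<integral>g. \<bar>entropy_density (exp 1) \<pi> \<rho> g\<bar> \<partial>\<rho>) + 1"
  have Y_section'[measurable]: "(\<lambda>g. Y g \<omega>) \<in> borel_measurable G" if "\<omega> \<in> space P" for \<omega>
    using measurable_compose[OF measurable_Pair2'[OF that] Y_meas] by simp
  have "AE \<omega> in P. (\<integral>\<^sup>+g. ennreal (- Y g \<omega>) \<partial>\<rho>) \<le> ennreal ?C"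
    using Y_exp AE_space
  proof eventually_elim
    case (elim \<omega>)
    note [measurable] = Y_section'[OF elim(2)]
    show ?case
      by (rule donsker_varadhan_neg_part[where e="\<lambda>g. ennreal (exp (- Y g \<omega>))"])
         (use elim KL in \<open>auto simp: p\<rho> sets_\<rho>\<pi> prob_space_prior\<close>)
  qed
  then have "(\<integral>\<^sup>+\<omega>. \<integral>\<^sup>+g. ennreal (- Y g \<omega>) \<partial>\<rho> \<partial>P) \<le> (\<integral>\<^sup>+\<omega>. ennreal ?C \<partial>P)"
    by (rule nn_integral_mono_AE)
  also have "\<dots> < \<infinity>" by (simp add: P.emeasure_space_1)
  also have "(\<integral>\<^sup>+\<omega>. \<integral>\<^sup>+g. ennreal (- Y g \<omega>) \<partial>\<rho> \<partial>P) = (\<integral>\<^sup>+g. \<integral>\<^sup>+\<omega>. ennreal (- Y g \<omega>) \<partial>P \<partial>\<rho>)"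
    using \<rho>P.Fubini[of "\<lambda>(g, \<omega>). ennreal (- Y g \<omega>)"] by simp
  finally have Y_neg: "(\<integral>\<^sup>+g. \<integral>\<^sup>+\<omega>. ennreal (- Y g \<omega>) \<partial>P \<partial>\<rho>) < \<infinity>" .
  then have "AE g in \<rho>. (\<integral>\<^sup>+\<omega>. ennreal (- Y g \<omega>) \<partial>P) \<noteq> \<infinity>"
    by (intro nn_integral_PInf_AE) auto
  moreover have "AE g in \<rho>. D g < \<infinity>"
    using eD by (rule AE_less_infty_of_ext_expectation) simp
  ultimately have good: "AE g in \<rho>. g \<in> space G \<and> integrable P (\<lambda>\<omega>. max 0 (- Y g \<omega>))
      \<and> integrable P (\<lambda>\<omega>. max 0 (\<Delta> g \<omega>))"
    using AE_space
  proof eventually_elim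
    case (elim g)
    then have g: "g \<in> space G" by (simp add: space_\<rho>)
    note [measurable] = Y_section[OF g] \<Delta>_section[OF g]
    have "(\<integral>\<^sup>+\<omega>. ennreal (\<Delta> g \<omega>) \<partial>P) < \<infinity>"
      using pos_part_finite_of_ext_expectation[of P "\<lambda>\<omega>. ereal (\<Delta> g \<omega>)"] elim
      by (simp add: D_def expected_cum_delta_def \<Delta>_def)
    with elim g show ?case
      by (simp add: integrable_pos_part_iff less_top)
  qed
  have \<Lambda>_neg: "integrable P (\<lambda>\<omega>. max 0 (- \<Lambda> \<omega>))"
  proof (rule Bochner_Integration.integrable_bound)
    show "integrable P (\<lambda>\<omega>. \<Sum>i=1..n. max 0 (- L (Z i) (\<omega> (i - 1))))"
      using neg L_meas unfolding P_def[symmetric]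
      by (intro Bochner_Integration.integrable_sum) (auto simp: integrable_pos_part_iff)
    have "- \<Lambda> \<omega> \<le> (\<Sum>i=1..n. max 0 (- L (Z i) (\<omega> (i - 1))))" for \<omega>
      unfolding \<Lambda>_def sum_negf[symmetric] by (intro sum_mono) auto
    moreover have "0 \<le> (\<Sum>i=1..n. max 0 (- L (Z i) (\<omega> (i - 1))))" for \<omega>
      by (intro sum_nonneg) auto
    ultimately show "AE \<omega> in P. norm (max 0 (- \<Lambda> \<omega>)) \<le> norm (\<Sum>i=1..n. max 0 (- L (Z i) (\<omega> (i - 1))))"
      by auto
  qed simp
  have M_eq: "M n \<omega> = lam * \<Lambda> \<omega> + Y g \<omega> - lam * l g - lam * \<Delta> g \<omega>" for g \<omega>
    by (simp add: M_def Y_def \<Lambda>_def algebra_simps)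
  \<comment> \<open>The left side of \<open>M_eq\<close> is free of g. A single g with the two
    one-sided bounds therefore suffices to control the negative part of M n.\<close>
  have "\<exists>g. g \<in> space G \<and> integrable P (\<lambda>\<omega>. max 0 (- Y g \<omega>)) \<and> integrable P (\<lambda>\<omega>. max 0 (\<Delta> g \<omega>))"
  proof (rule ccontr)
    assume none: "\<not> ?thesis"
    from good have "AE g in \<rho>. False"
      by eventually_elim (use none in blast)
    then show False by (simp add: \<rho>.AE_False)
  qed
  then obtain g\<^sub>0 where g\<^sub>0: "g\<^sub>0 \<in> space G" "integrable P (\<lambda>\<omega>. max 0 (- Y g\<^sub>0 \<omega>))"
      "integrable P (\<lambda>\<omega>. max 0 (\<Delta> g\<^sub>0 \<omega>))" by blast
  have mult_max: "lam * max 0 x = max 0 (lam * x)" for x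
    using lam by (simp add: max_mult_distrib_left)
  have "integrable P (\<lambda>\<omega>. max 0 (- M n \<omega>))"
  proof (rule Bochner_Integration.integrable_bound)
    show "integrable P (\<lambda>\<omega>. lam * max 0 (- \<Lambda> \<omega>) + max 0 (- Y g\<^sub>0 \<omega>) + \<bar>lam * l g\<^sub>0\<bar>
            + lam * max 0 (\<Delta> g\<^sub>0 \<omega>))"
      using \<Lambda>_neg g\<^sub>0 by auto
    show "AE \<omega> in P. norm (max 0 (- M n \<omega>)) \<le> norm (lam * max 0 (- \<Lambda> \<omega>) + max 0 (- Y g\<^sub>0 \<omega>)
            + \<bar>lam * l g\<^sub>0\<bar> + lam * max 0 (\<Delta> g\<^sub>0 \<omega>))"
      unfolding M_eq[of _ g\<^sub>0] mult_max by (intro AE_I2) simp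
  qed simp
  then have "(\<integral>\<^sup>+\<omega>. ennreal (- M n \<omega>) \<partial>P) < \<infinity>"
    by (subst (asm) integrable_pos_part_iff) auto
  then have M_int: "integrable P (M n)" and M_le: "(\<integral>\<omega>. M n \<omega> \<partial>P) \<le> 0"
    using M_supermartingale[OF order_refl] by (auto simp: P_def)
  \<comment> \<open>Once M n is integrable, \<open>M_eq\<close> solved for Y bounds its positive
    part by means of the negative part of \<Lambda> and the positive part of \<Delta>.\<close>
  have Y_int: "integrable P (Y g)"
    if g: "g \<in> space G" "integrable P (\<lambda>\<omega>. max 0 (- Y g \<omega>))" "integrable P (\<lambda>\<omega>. max 0 (\<Delta> g \<omega>))" for g
  proof (rule Bochner_Integration.integrable_bound)
    show "integrable P (\<lambda>\<omega>. lam * max 0 (- \<Lambda> \<omega>) + max 0 (- Y g \<omega>) + \<bar>lam * l g\<bar>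
            + lam * max 0 (\<Delta> g \<omega>) + \<bar>M n \<omega>\<bar>)"
      using \<Lambda>_neg g M_int by auto
    show "AE \<omega> in P. norm (Y g \<omega>) \<le> norm (lam * max 0 (- \<Lambda> \<omega>) + max 0 (- Y g \<omega>)
            + \<bar>lam * l g\<bar> + lam * max 0 (\<Delta> g \<omega>) + \<bar>M n \<omega>\<bar>)"
      unfolding M_eq[of _ g] mult_max by (intro AE_I2) simp
  qed (rule Y_section[OF g(1)])
  have "integrable P (\<lambda>\<omega>. lam * \<Lambda> \<omega>)"
  proof (rule Bochner_Integration.integrable_bound)
    show "integrable P (\<lambda>\<omega>. lam * max 0 (- \<Lambda> \<omega>) + \<bar>Y g\<^sub>0 \<omega>\<bar> + \<bar>lam * l g\<^sub>0\<bar>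
            + lam * max 0 (\<Delta> g\<^sub>0 \<omega>) + \<bar>M n \<omega>\<bar>)"
      using \<Lambda>_neg g\<^sub>0 M_int Y_int[OF g\<^sub>0] by auto
    show "AE \<omega> in P. norm (lam * \<Lambda> \<omega>) \<le> norm (lam * max 0 (- \<Lambda> \<omega>) + \<bar>Y g\<^sub>0 \<omega>\<bar>
            + \<bar>lam * l g\<^sub>0\<bar> + lam * max 0 (\<Delta> g\<^sub>0 \<omega>) + \<bar>M n \<omega>\<bar>)"
      unfolding M_eq[of _ g\<^sub>0] mult_max by (intro AE_I2) simp
  qed simp
  then have \<Lambda>_int: "integrable P \<Lambda>"
    using lam by simp
  \<comment> \<open>Taking expectations in \<open>M_eq\<close> leads to y = lam * l + lam * d - c
    almost everywhere. The supermartingale property will enter as lam * E \<Lambda> \<le> c.\<close>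
  define c where "c = lam * (\<integral>\<omega>. \<Lambda> \<omega> \<partial>P) - (\<integral>\<omega>. M n \<omega> \<partial>P)"
  define d where "d g = (\<integral>\<omega>. \<Delta> g \<omega> \<partial>P)" for g
  define y where "y g = (\<integral>\<omega>. Y g \<omega> \<partial>P)" for g
  have [measurable]: "d \<in> borel_measurable G" "y \<in> borel_measurable G"
    unfolding d_def y_def by measurable
  have good': "AE g in \<rho>. integrable P (Y g) \<and> integrable P (\<lambda>\<omega>. max 0 (- Y g \<omega>))
      \<and> D g = ereal (d g) \<and> y g = lam * l g + lam * d g - c"
    using good
  proof eventually_elim
    case (elim g)
    then have Y: "integrable P (Y g)" using Y_int by blast
    have "integrable P (\<lambda>\<omega>. (lam * \<Lambda> \<omega> + Y g \<omega> - lam * l g - M n \<omega>) / lam)"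
      using Y \<Lambda>_int M_int by auto
    also have "(\<lambda>\<omega>. (lam * \<Lambda> \<omega> + Y g \<omega> - lam * l g - M n \<omega>) / lam) = \<Delta> g"
      using lam by (simp add: fun_eq_iff M_eq[of _ g])
    finally have \<Delta>: "integrable P (\<Delta> g)" .
    have "D g = ereal (d g)"
      using ext_expectation_integrable[OF \<Delta>] by (simp add: D_def expected_cum_delta_def \<Delta>_def d_def)
    moreover have "y g = (\<integral>\<omega>. lam * l g + lam * \<Delta> g \<omega> + M n \<omega> - lam * \<Lambda> \<omega> \<partial>P)"
      unfolding y_def by (intro Bochner_Integration.integral_cong) (auto simp: M_eq[of _ g])
    moreover have "\<dots> = lam * l g + lam * d g - c"
      using \<Delta> \<Lambda>_int M_int by (simp add: d_def c_def P.prob_space)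
    ultimately show ?case using Y elim by simp
  qed

  have l_pos: "integrable \<rho> (\<lambda>g. max 0 (l g))"
    using pos_part_finite_of_ext_expectation[OF el] by (simp add: integrable_pos_part_iff)
  have "(\<integral>\<^sup>+g. ennreal (d g) \<partial>\<rho>) = (\<integral>\<^sup>+g. e2ennreal (D g) \<partial>\<rho>)"
    using good' by (intro nn_integral_cong_AE, eventually_elim) auto
  then have d_pos: "integrable \<rho> (\<lambda>g. max 0 (d g))"
    using pos_part_finite_of_ext_expectation[OF eD] by (simp add: integrable_pos_part_iff)
  have "(\<integral>\<^sup>+p. ennreal (- (case p of (g, \<omega>) \<Rightarrow> Y g \<omega>)) \<partial>(\<rho> \<Otimes>\<^sub>M P)) < \<infinity>"
    using Y_neg P.nn_integral_fst[of "\<lambda>(g, \<omega>). ennreal (- Y g \<omega>)" \<rho>] by (simp add: split_beta')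
  then have "integrable (\<rho> \<Otimes>\<^sub>M P) (\<lambda>p. max 0 (- (case p of (g, \<omega>) \<Rightarrow> Y g \<omega>)))"
    by (subst integrable_pos_part_iff) auto
  then have "integrable (\<rho> \<Otimes>\<^sub>M P) (\<lambda>(g, \<omega>). max 0 (- Y g \<omega>))"
    by (simp add: split_beta')
  then have ny: "integrable \<rho> (\<lambda>g. \<integral>\<omega>. max 0 (- Y g \<omega>) \<partial>P)"
    by (rule \<rho>P.integrable_fst)
  \<comment> \<open>From below y is controlled by the negative part of Y, from above by the positive
    parts of l and d.\<close>
  have y_int: "integrable \<rho> y"
  proof (rule Bochner_Integration.integrable_bound)
    show "integrable \<rho> (\<lambda>g. (\<integral>\<omega>. max 0 (- Y g \<omega>) \<partial>P) + lam * max 0 (l g) + lam * max 0 (d g) + \<bar>c\<bar>)"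
      using ny l_pos d_pos by auto
    show "AE g in \<rho>. norm (y g)
        \<le> norm ((\<integral>\<omega>. max 0 (- Y g \<omega>) \<partial>P) + lam * max 0 (l g) + lam * max 0 (d g) + \<bar>c\<bar>)"
      using good'
    proof eventually_elim
      case (elim g)
      have "(\<integral>\<omega>. - Y g \<omega> \<partial>P) \<le> (\<integral>\<omega>. max 0 (- Y g \<omega>) \<partial>P)"
        using elim by (intro integral_mono) auto
      then have "- y g \<le> (\<integral>\<omega>. max 0 (- Y g \<omega>) \<partial>P)" by (simp add: y_def)
      moreover have "0 \<le> (\<integral>\<omega>. max 0 (- Y g \<omega>) \<partial>P)" by (intro Bochner_Integration.integral_nonneg) auto
      moreover have "y g = lam * l g + lam * d g - c" using elim by simp
      ultimately have "\<bar>y g\<bar>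
          \<le> (\<integral>\<omega>. max 0 (- Y g \<omega>) \<partial>P) + lam * max 0 (l g) + lam * max 0 (d g) + \<bar>c\<bar>"
        unfolding mult_max by linarith
      then show ?case by simp
    qed
  qed simp
  \<comment> \<open>Since \<bar>t\<bar> = t + 2 * max 0 (- t), the inner integral of the norm is a
    combination of two functions already known to be integrable.\<close>
  have Y_joint: "integrable (\<rho> \<Otimes>\<^sub>M P) (\<lambda>(g, \<omega>). Y g \<omega>)"
  proof (rule \<rho>P.Fubini_integrable)
    show "AE g in \<rho>. integrable P (\<lambda>\<omega>. case (g, \<omega>) of (g, \<omega>) \<Rightarrow> Y g \<omega>)"
      using good' by eventually_elim simp
    have "integrable \<rho> (\<lambda>g. y g + 2 * (\<integral>\<omega>. max 0 (- Y g \<omega>) \<partial>P))"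
      using y_int ny by auto
    moreover have "AE g in \<rho>. (\<integral>\<omega>. norm (case (g, \<omega>) of (g, \<omega>) \<Rightarrow> Y g \<omega>) \<partial>P)
        = y g + 2 * (\<integral>\<omega>. max 0 (- Y g \<omega>) \<partial>P)"
      using good'
    proof eventually_elim
      case (elim g)
      have "(\<integral>\<omega>. norm (Y g \<omega>) \<partial>P) = (\<integral>\<omega>. Y g \<omega> + 2 * max 0 (- Y g \<omega>) \<partial>P)"
        by (intro Bochner_Integration.integral_cong) auto
      also have "\<dots> = y g + 2 * (\<integral>\<omega>. max 0 (- Y g \<omega>) \<partial>P)"
        using elim by (simp add: y_def)
      finally show ?case by simp
    qed
    ultimately show "integrable \<rho> (\<lambda>g. \<integral>\<omega>. norm (case (g, \<omega>) of (g, \<omega>) \<Rightarrow> Y g \<omega>) \<partial>P)"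
      by (subst integrable_cong_AE) auto
  qed simp
  obtain k where k: "KL \<rho> \<pi> = ereal k"
    using KL by (auto simp: KL_def split: if_splits)
  have "AE \<omega> in P. - k \<le> (\<integral>g. Y g \<omega> \<partial>\<rho>)"
    using Y_exp \<rho>P.AE_integrable_snd[OF Y_joint] AE_space
  proof eventually_elim
    case (elim \<omega>)
    note [measurable] = Y_section'[OF elim(3)]
    have "ereal (- (\<integral>g. Y g \<omega> \<partial>\<rho>)) \<le> KL \<rho> \<pi>"
      by (rule donsker_varadhan[where e="\<lambda>g. ennreal (exp (- Y g \<omega>))"])
         (use elim KL in \<open>auto simp: p\<rho> sets_\<rho>\<pi> prob_space_prior\<close>)
    then show ?case by (simp add: k)
  qed
  then have "(\<integral>\<omega>. - k \<partial>P) \<le> (\<integral>\<omega>. (\<integral>g. Y g \<omega> \<partial>\<rho>) \<partial>P)"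
    using \<rho>P.integrable_snd[OF Y_joint] by (intro integral_mono_AE) auto
  then have y_ge: "- k \<le> (\<integral>g. y g \<partial>\<rho>)"
    using \<rho>P.Fubini_integral[OF Y_joint] by (simp add: y_def P.prob_space)
  \<comment> \<open>The sum l + d is affine in y and hence integrable. With both positive parts
    integrable, each of l and d is integrable by itself, and their expectations can be
    separated.\<close>
  have ld_bound: "integrable \<rho> (\<lambda>g. max 0 (l g) + max 0 (d g) + \<bar>y g + c\<bar> / lam)"
    using l_pos d_pos y_int by auto
  have ld: "AE g in \<rho>. l g + d g = (y g + c) / lam"
    using good' by eventually_elim (use lam in \<open>simp add: field_simps\<close>)
  have l_int: "integrable \<rho> l"
  proof (rule Bochner_Integration.integrable_bound[OF ld_bound])
    show "AE g in \<rho>. norm (l g) \<le> norm (max 0 (l g) + max 0 (d g) + \<bar>y g + c\<bar> / lam)"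
      using ld
    proof eventually_elim
      case (elim g)
      have "\<bar>y g + c\<bar> / lam = \<bar>l g + d g\<bar>" unfolding elim using lam by simp
      then show ?case by simp
    qed
  qed simp
  have d_int: "integrable \<rho> d"
  proof (rule Bochner_Integration.integrable_bound[OF ld_bound])
    show "AE g in \<rho>. norm (d g) \<le> norm (max 0 (l g) + max 0 (d g) + \<bar>y g + c\<bar> / lam)"
      using ld
    proof eventually_elim
      case (elim g)
      have "\<bar>y g + c\<bar> / lam = \<bar>l g + d g\<bar>" unfolding elim using lam by simp
      then show ?case by simp
    qed
  qed simp
  have "(\<integral>g. y g \<partial>\<rho>) = (\<integral>g. lam * l g + lam * d g - c \<partial>\<rho>)"
    using good' by (intro integral_cong_AE) auto
  also have "\<dots> = lam * (\<integral>g. l g \<partial>\<rho>) + lam * (\<integral>g. d g \<partial>\<rho>) - c"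
    using l_int d_int by (simp add: \<rho>.prob_space)
  finally have "lam * (\<integral>\<omega>. \<Lambda> \<omega> \<partial>P) \<le> lam * ((\<integral>g. l g \<partial>\<rho>) + (\<integral>g. d g \<partial>\<rho>)) + k"
    using y_ge M_le by (simp add: c_def algebra_simps)
  then have final: "(\<integral>\<omega>. \<Lambda> \<omega> \<partial>P) \<le> (\<integral>g. l g \<partial>\<rho>) + (\<integral>g. d g \<partial>\<rho>) + k / lam"
    using lam by (simp add: field_simps)
  have "ext_expectation \<rho> D = ext_expectation \<rho> (\<lambda>g. ereal (d g))"
    using good' by (intro ext_expectation_cong_AE, eventually_elim) auto
  also have "\<dots> = ereal (\<integral>g. d g \<partial>\<rho>)" by (rule ext_expectation_integrable[OF d_int])
  finally have "seqrand_bound P L lam \<delta> \<pi> Z n \<rho> = ereal ((\<integral>g. l g \<partial>\<rho>) + (\<integral>g. d g \<partial>\<rho>) + k / lam)"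
    using ext_expectation_integrable[OF l_int] lam by (simp add: seqrand_bound_def l_def D_def k)
  moreover have "expected_cum_loss P L Z n = ereal (\<integral>\<omega>. \<Lambda> \<omega> \<partial>P)"
    unfolding expected_cum_loss_def \<Lambda>_def
    using \<Lambda>_int neg L_meas unfolding \<Lambda>_def[abs_def] P_def[symmetric]
    by (intro ext_expectation_sum) auto
  ultimately show ?thesis using final by (simp add: P_def)
qed simp

text \<open>This treats the second alternative of \<open>cum_loss_exists\<close> when some negative
  part is infinite. No summand is \<infinity>, so the summand -\<infinity> decides the
  \<open>ereal\<close> sum and the bound becomes trivial.\<close>

lemma expected_loss_eq_MInf:
  assumes pos: "\<And>i. i \<in> {1..n} \<Longrightarrow> (\<integral>\<^sup>+\<omega>. ennreal (L (Z i) (\<omega> (i - 1))) \<partial>law n) < \<infinity>"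
    and j: "j \<in> {1..n}" "(\<integral>\<^sup>+\<omega>. ennreal (- L (Z j) (\<omega> (j - 1))) \<partial>law n) = \<infinity>"
  shows "expected_cum_loss (law n) L Z n = - \<infinity>"
proof -
  let ?E = "\<lambda>i. ext_expectation (law n) (\<lambda>\<omega>. ereal (L (Z i) (\<omega> (i - 1))))"
  have "?E i \<noteq> \<infinity>" if "i \<in> {1..n}" for i
    using pos[OF that]
    by (cases "\<integral>\<^sup>+\<omega>. ennreal (L (Z i) (\<omega> (i - 1))) \<partial>law n")
       (auto simp: ext_expectation_def enn2ereal_ennreal ereal_minus_eq_PInfty_iff)
  then have "sum ?E ({1..n} - {j}) \<noteq> \<infinity>"
    by (auto simp: sum_Pinfty)
  moreover have "?E j = - \<infinity>"
    using pos[OF j(1)] j(2) by (intro ext_expectation_eq_MInf) auto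
  ultimately show ?thesis
    using j by (simp add: expected_cum_loss_def sum.remove[of _ j])
qed

end

section \<open>The general bound, its attained minimum, and the finite model\<close>

theorem theorem4p6:
  fixes MX :: "'x measure" and MY :: "'y measure"
    and GB G \<pi> :: "('x \<Rightarrow> 'y) measure"
    and L :: "'x \<times> 'y \<Rightarrow> ('x \<Rightarrow> 'y) \<Rightarrow> real"
    and \<delta> :: "'x \<times> 'y \<Rightarrow> ('x \<Rightarrow> 'y) \<Rightarrow> ('x \<Rightarrow> 'y) \<Rightarrow> real"
    and lam :: real and n :: nat and Z :: "nat \<Rightarrow> 'x \<times> 'y"
    and pihat :: "('x \<Rightarrow> 'y) measure \<Rightarrow> ('x \<Rightarrow> 'y) measure"
    and law :: "(nat \<Rightarrow> 'x \<Rightarrow> 'y) measure"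
  assumes GB: "space GB = prediction_functions MX MY"
    and G: "space G \<subseteq> space GB"
    and lam: "lam > 0"
    and prior: "\<pi> \<in> space (prob_algebra G)"
    and L_GB: "\<And>z. z \<in> space MX \<times> space MY \<Longrightarrow> L z \<in> borel_measurable GB"
    and L_G: "\<And>z. z \<in> space MX \<times> space MY \<Longrightarrow> L z \<in> borel_measurable G"
    and delta: "\<And>z. z \<in> space MX \<times> space MY \<Longrightarrow>
                  (\<lambda>(g, g'). \<delta> z g g') \<in> borel_measurable (G \<Otimes>\<^sub>M GB)"
    and ovi: "online_variance_inequality (space MX \<times> space MY) G GB L lam \<delta> pihat"
    and Z: "\<And>i. i \<in> {1..n} \<Longrightarrow> Z i \<in> space MX \<times> space MY"
    and kernel: "\<And>i. i < n \<Longrightarrow>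
                   seqrand_rho L lam \<delta> pihat \<pi> Z i \<in> PiM {0..<i} (\<lambda>_. GB) \<rightarrow>\<^sub>M prob_algebra GB"
    and law: "law = seqrand_law GB L lam \<delta> pihat \<pi> Z n"
    and loss_exists: "cum_loss_exists law L Z n"
  shows "expected_cum_loss law L Z n
           \<le> (INF \<rho>\<in>space (prob_algebra G). seqrand_bound law L lam \<delta> \<pi> Z n \<rho>)
       \<and> ((\<exists>c::real. \<forall>g\<in>space G. c \<le> (\<Sum>i=1..n. L (Z i) g) \<and>
                                     ereal c \<le> expected_cum_delta law \<delta> Z n g) \<longrightarrow>
            (\<exists>\<rho>\<^sub>0\<in>space (prob_algebra G). \<forall>\<rho>\<in>space (prob_algebra G).
               seqrand_bound law L lam \<delta> \<pi> Z n \<rho>\<^sub>0 \<le> seqrand_bound law L lam \<delta> \<pi> Z n \<rho>))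
       \<and> (finite (space G) \<and> \<pi> = uniform_count_measure (space G) \<longrightarrow>
            expected_cum_loss law L Z n
              \<le> (MIN g\<in>space G. ereal (\<Sum>i=1..n. L (Z i) g) + expected_cum_delta law \<delta> Z n g
                                  + ereal (ln (real (card (space G))) / lam)))"
proof -
  interpret seqrand_run "space MX \<times> space MY" GB G \<pi> L \<delta> lam n Z pihat
    using lam prior L_GB L_G delta ovi Z kernel by unfold_locales
  have le: "expected_cum_loss law L Z n \<le> seqrand_bound law L lam \<delta> \<pi> Z n \<rho>"
    if \<rho>: "\<rho> \<in> space (prob_algebra G)" for \<rho>
  proof (cases "\<forall>i\<in>{1..n}. (\<integral>\<^sup>+\<omega>. ennreal (- L (Z i) (\<omega> (i - 1))) \<partial>law) < \<infinity>")
    case True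
    then show ?thesis
      unfolding law by (intro expected_loss_le_bound[OF \<rho>]) auto
  next
    case False
    then obtain j where "j \<in> {1..n}" "(\<integral>\<^sup>+\<omega>. ennreal (- L (Z j) (\<omega> (j - 1))) \<partial>law) = \<infinity>"
      by (auto simp: less_top[symmetric])
    moreover have "\<forall>i\<in>{1..n}. (\<integral>\<^sup>+\<omega>. ennreal (L (Z i) (\<omega> (i - 1))) \<partial>law) < \<infinity>"
      using loss_exists False by (auto simp: cum_loss_exists_def)
    ultimately have "expected_cum_loss law L Z n = - \<infinity>"
      unfolding law by (intro expected_loss_eq_MInf) auto
    then show ?thesis by simp
  qed
  have D_meas: "expected_cum_delta law \<delta> Z n \<in> borel_measurable G"
    unfolding law by (rule measurable_expected_cum_delta)
  show ?thesis
  proof (intro conjI impI)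
    show "expected_cum_loss law L Z n
        \<le> (INF \<rho>\<in>space (prob_algebra G). seqrand_bound law L lam \<delta> \<pi> Z n \<rho>)"
      by (rule INF_greatest) (rule le)
  next
    assume "\<exists>c::real. \<forall>g\<in>space G. c \<le> (\<Sum>i=1..n. L (Z i) g) \<and> ereal c \<le> expected_cum_delta law \<delta> Z n g"
    then obtain c where "\<And>g. g \<in> space G \<Longrightarrow> c \<le> (\<Sum>i=1..n. L (Z i) g)"
        "\<And>g. g \<in> space G \<Longrightarrow> ereal c \<le> expected_cum_delta law \<delta> Z n g" by auto
    from gibbs_variational_minimiser[OF prior lam measurable_cum_loss D_meas this]
    show "\<exists>\<rho>\<^sub>0\<in>space (prob_algebra G). \<forall>\<rho>\<in>space (prob_algebra G).
        seqrand_bound law L lam \<delta> \<pi> Z n \<rho>\<^sub>0 \<le> seqrand_bound law L lam \<delta> \<pi> Z n \<rho>"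
      unfolding seqrand_bound_def .
  next
    assume fin: "finite (space G) \<and> \<pi> = uniform_count_measure (space G)"
    \<comment> \<open>A uniform counting measure carries all subsets, and the prior has the sets of
      G; so G is discrete.\<close>
    then have sets_G: "sets G = Pow (space G)"
      using sets_prior by (metis sets_uniform_count_measure)
    have "expected_cum_loss law L Z n \<le> ereal (\<Sum>i=1..n. L (Z i) g)
        + expected_cum_delta law \<delta> Z n g + ereal (ln (real (card (space G))) / lam)"
      if g: "g \<in> space G" for g
    proof -
      \<comment> \<open>The bound is taken at the point mass at g, where expectations become
        evaluations and the divergence is the logarithm of the cardinality.\<close>
      have "return G g \<in> space (prob_algebra G)"
        using g by (simp add: space_prob_algebra prob_space_return)
      from le[OF this] show ?thesis
        using fin g lam KL_return_uniform[OF _ g sets_G] D_meas measurable_cum_loss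
        by (simp add: seqrand_bound_def ext_expectation_return)
    qed
    then show "expected_cum_loss law L Z n
        \<le> (MIN g\<in>space G. ereal (\<Sum>i=1..n. L (Z i) g) + expected_cum_delta law \<delta> Z n g
              + ereal (ln (real (card (space G))) / lam))"
      using fin \<pi>.not_empty space_prior by (subst Min_ge_iff) auto
  qed
qed

end
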